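(* Let $s<-1$. The Cauchy problem for the KdV-Burgers equation $u_t+u_{xxx}-u_{xx}+uu_x=0$ on $\mathbb{T}=\mathbb{R}/2\pi\mathbb{Z}$ is ill-posed in $H^s(\mathbb{T})$ in the following sense: there exists $T>0$ such that for every $0<t<T$, the flow-map $u_0\mapsto u(t)$, defined on $H^{-1}(\mathbb{T})$, is discontinuous at the origin from $H^{-1}(\mathbb{T})$ endowed with the topology induced by $H^s(\mathbb{T})$ into $\mathcal{D}'(\mathbb{T})$.
   Context: All functions are real valued. The flow-map is the one given by the analytic well-posedness of the equation in $H^{-1}(\mathbb{T})$: for every $u_0\in H^{-1}(\mathbb{T})$ the equation has a global solution $u\in C([0,\infty);H^{-1}(\mathbb{T}))$ with $u(0)=u_0$, in the sense of the integral formulation $$u(t)=S(t)u_0-\frac12\int_0^tS(t-t')\,\partial_x(u^2)(t')\,dt',\qquad S(t)\phi=\sum_{k\in\mathbb{Z}}\exp(itk^3-tk^2)\hat\phi(k)e^{ikx},$$ and, around each point $u_0\in H^{-1}(\mathbb{T})$, the map $u_0\mapsto u$ is analytic from a ball of $H^{-1}(\mathbb{T})$ centered at $u_0$ into $C([0,T(u_0)];H^{-1}(\mathbb{T}))$ for some $T(u_0)>0$. For smooth $u_0$, $u$ is the classical smooth solution, so the flow-map on $H^{-1}(\mathbb{T})$ is the continuous extension of the classical flow-map on smooth data. $\mathcal{D}'(\mathbb{T})$ is the space of distributions on $\mathbb{T}$. *)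

theory Defs
  imports "HOL-Analysis.Analysis"
begin

text \<open>Everything is real valued; functions on the torus are \<open>2 * pi\<close>-periodic functions on the line.\<close>

definition smooth_real :: "(real \<Rightarrow> real) \<Rightarrow> bool" where
  "smooth_real f \<longleftrightarrow> (\<forall>n x. (deriv ^^ n) f differentiable (at x))"

definition torus_periodic :: "(real \<Rightarrow> real) \<Rightarrow> bool" where
  "torus_periodic f \<longleftrightarrow> (\<forall>x. f (x + 2 * pi) = f x)"

lemma higher_deriv_const_0: "(deriv ^^ n) (\<lambda>x::real. 0::real) = (\<lambda>x. 0)"
  by (induction n) auto

lemma smooth_real_0: "smooth_real (\<lambda>x. 0)"
  by (simp add: smooth_real_def higher_deriv_const_0)

lemma smooth_real_DERIV:
  assumes "smooth_real f"
  shows "((deriv ^^ n) f has_real_derivative (deriv ^^ Suc n) f x) (at x)"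
  using assms unfolding smooth_real_def
  by (auto simp: DERIV_deriv_iff_real_differentiable)

lemma higher_deriv_add_real:
  assumes "smooth_real f" "smooth_real g"
  shows "(deriv ^^ n) (\<lambda>x. f x + g x) = (\<lambda>x. (deriv ^^ n) f x + (deriv ^^ n) g x)"
proof (induction n)
  case (Suc n)
  show ?case
  proof
    fix x
    have "((\<lambda>x. (deriv ^^ n) f x + (deriv ^^ n) g x) has_real_derivative
             (deriv ^^ Suc n) f x + (deriv ^^ Suc n) g x) (at x)"
      by (intro DERIV_add smooth_real_DERIV assms)
    then show "(deriv ^^ Suc n) (\<lambda>x. f x + g x) x = (deriv ^^ Suc n) f x + (deriv ^^ Suc n) g x"
      using Suc.IH by (simp add: DERIV_imp_deriv)
  qed
qed auto

lemma higher_deriv_cmult_real: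
  assumes "smooth_real f"
  shows "(deriv ^^ n) (\<lambda>x. c * f x) = (\<lambda>x. c * (deriv ^^ n) f x)"
proof (induction n)
  case (Suc n)
  show ?case
  proof
    fix x
    have "((\<lambda>x. c * (deriv ^^ n) f x) has_real_derivative c * (deriv ^^ Suc n) f x) (at x)"
      by (intro DERIV_cmult smooth_real_DERIV assms)
    then show "(deriv ^^ Suc n) (\<lambda>x. c * f x) x = c * (deriv ^^ Suc n) f x"
      using Suc.IH by (simp add: DERIV_imp_deriv)
  qed
qed auto

lemma smooth_real_add:
  assumes "smooth_real f" "smooth_real g" shows "smooth_real (\<lambda>x. f x + g x)"
  using assms by (auto simp: smooth_real_def higher_deriv_add_real[OF assms] intro!: differentiable_add)

lemma smooth_real_cmult:
  assumes "smooth_real f" shows "smooth_real (\<lambda>x. c * f x)"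
  using assms by (auto simp: smooth_real_def higher_deriv_cmult_real[OF assms] intro!: differentiable_mult)

lemma higher_deriv_cos_real:
  "(deriv ^^ n) (\<lambda>x. cos (a * x + b)) = (\<lambda>x::real. a ^ n * cos (a * x + b + real n * (pi / 2)))"
proof (induction n)
  case (Suc n)
  show ?case
  proof
    fix x :: real
    have "((\<lambda>x. a ^ n * cos (a * x + b + real n * (pi / 2))) has_real_derivative
             a ^ n * (- sin (a * x + b + real n * (pi / 2)) * a)) (at x)"
      by (auto intro!: derivative_eq_intros)
    moreover have "- sin y = cos (y + pi / 2)" for y :: real
      by (simp add: cos_add)
    ultimately show "(deriv ^^ Suc n) (\<lambda>x. cos (a * x + b)) x
        = a ^ Suc n * cos (a * x + b + real (Suc n) * (pi / 2))"
      using Suc.IH by (simp add: DERIV_imp_deriv algebra_simps add_divide_distrib)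
  qed
qed auto

lemma smooth_real_cos: "smooth_real (\<lambda>x. cos (a * x + b))"
proof -
  have "(\<lambda>x. a ^ n * cos (a * x + b + real n * (pi / 2))) differentiable (at x)" for n x
    unfolding real_differentiable_def by (rule exI) (auto intro!: derivative_eq_intros)
  then show ?thesis
    by (simp add: smooth_real_def higher_deriv_cos_real)
qed

typedef test = "{f :: real \<Rightarrow> real. smooth_real f \<and> torus_periodic f}"
  morphisms test_fun Abs_test
  by (rule exI[of _ "\<lambda>x. 0"]) (simp add: smooth_real_0 torus_periodic_def)

setup_lifting type_definition_test

instantiation test :: real_vector
begin

lift_definition zero_test :: test is "\<lambda>x. 0"
  by (simp add: smooth_real_0 torus_periodic_def)

lift_definition plus_test :: "test \<Rightarrow> test \<Rightarrow> test" is "\<lambda>f g x. f x + g x"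
  by (simp add: smooth_real_add torus_periodic_def)

lift_definition uminus_test :: "test \<Rightarrow> test" is "\<lambda>f x. - f x"
  using smooth_real_cmult[of _ "-1"] by (simp add: torus_periodic_def)

lift_definition minus_test :: "test \<Rightarrow> test \<Rightarrow> test" is "\<lambda>f g x. f x - g x"
  using smooth_real_add[OF _ smooth_real_cmult[of _ "-1"]] by (simp add: torus_periodic_def)

lift_definition scaleR_test :: "real \<Rightarrow> test \<Rightarrow> test" is "\<lambda>c f x. c * f x"
  by (simp add: smooth_real_cmult torus_periodic_def)

instance
  by standard (transfer; simp add: algebra_simps)+

end

text \<open>Continuity for the Frechet topology of smooth functions: the functional is controlled by
  finitely many of the norms \<open>sup |(d/dx)^j f|\<close>.\<close>

definition dist_continuous :: "(test \<Rightarrow> real) \<Rightarrow> bool" where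
  "dist_continuous u \<longleftrightarrow> (\<exists>C m. \<forall>f B.
     (\<forall>j\<le>m. \<forall>x. \<bar>(deriv ^^ j) (test_fun f) x\<bar> \<le> B) \<longrightarrow> \<bar>u f\<bar> \<le> C * B)"

lemma dist_continuous_0: "dist_continuous (\<lambda>f. 0)"
  unfolding dist_continuous_def by (rule exI[of _ 0]) simp

lemma dist_continuous_lincomb:
  assumes "dist_continuous u" "dist_continuous v"
  shows "dist_continuous (\<lambda>f. a * u f + b * v f)"
proof -
  obtain C m where 1: "\<And>f B. (\<forall>j\<le>m. \<forall>x. \<bar>(deriv ^^ j) (test_fun f) x\<bar> \<le> B) \<Longrightarrow> \<bar>u f\<bar> \<le> C * B"
    using assms(1) unfolding dist_continuous_def by blast
  obtain D n where 2: "\<And>f B. (\<forall>j\<le>n. \<forall>x. \<bar>(deriv ^^ j) (test_fun f) x\<bar> \<le> B) \<Longrightarrow> \<bar>v f\<bar> \<le> D * B"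
    using assms(2) unfolding dist_continuous_def by blast
  have "\<bar>a * u f + b * v f\<bar> \<le> (\<bar>a\<bar> * C + \<bar>b\<bar> * D) * B"
    if "\<forall>j\<le>max m n. \<forall>x. \<bar>(deriv ^^ j) (test_fun f) x\<bar> \<le> B" for f B
  proof -
    have "\<bar>u f\<bar> \<le> C * B" "\<bar>v f\<bar> \<le> D * B"
      using that by (auto intro!: 1 2)
    then have "\<bar>a\<bar> * \<bar>u f\<bar> + \<bar>b\<bar> * \<bar>v f\<bar> \<le> \<bar>a\<bar> * (C * B) + \<bar>b\<bar> * (D * B)"
      by (intro add_mono mult_left_mono) auto
    moreover have "\<bar>a * u f + b * v f\<bar> \<le> \<bar>a\<bar> * \<bar>u f\<bar> + \<bar>b\<bar> * \<bar>v f\<bar>"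
      by (metis abs_mult abs_triangle_ineq)
    ultimately show ?thesis
      by (simp add: algebra_simps)
  qed
  then show ?thesis
    unfolding dist_continuous_def by blast
qed

typedef distribution = "{u :: test \<Rightarrow> real. linear u \<and> dist_continuous u}"
  morphisms dist_apply Abs_distribution
  by (rule exI[of _ "\<lambda>f. 0"]) (simp add: dist_continuous_0 linear_0 module_hom_zero)

setup_lifting type_definition_distribution

instantiation distribution :: real_vector
begin

lift_definition zero_distribution :: distribution is "\<lambda>f. 0"
  by (simp add: dist_continuous_0 module_hom_zero)

lift_definition plus_distribution :: "distribution \<Rightarrow> distribution \<Rightarrow> distribution"
  is "\<lambda>u v f. u f + v f"
  using dist_continuous_lincomb[of _ _ 1 1] by (simp add: linear_compose_add)

lift_definition uminus_distribution :: "distribution \<Rightarrow> distribution" is "\<lambda>u f. - u f"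
  using dist_continuous_lincomb[OF _ dist_continuous_0, of _ "-1" 0] by (simp add: linear_compose_neg)

lift_definition minus_distribution :: "distribution \<Rightarrow> distribution \<Rightarrow> distribution"
  is "\<lambda>u v f. u f - v f"
  using dist_continuous_lincomb[of _ _ 1 "-1"] by (simp add: linear_compose_sub)

lift_definition scaleR_distribution :: "real \<Rightarrow> distribution \<Rightarrow> distribution"
  is "\<lambda>c u f. c * u f"
  using dist_continuous_lincomb[OF _ dist_continuous_0, of _ _ 0] linear_compose_scale_right
  by fastforce

instance
  by standard (transfer; simp add: algebra_simps)+

end

text \<open>The topology of \<open>D'\<close> is the weak one, i.e. pointwise convergence on test functions.\<close>

definition dist_topology :: "distribution topology" where
  "dist_topology = pullback_topology UNIV dist_apply (euclidean :: (test \<Rightarrow> real) topology)"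

lemma topspace_dist_topology [simp]: "topspace dist_topology = UNIV"
  by (simp add: dist_topology_def topspace_pullback_topology)

definition represents :: "(real \<Rightarrow> real) \<Rightarrow> distribution \<Rightarrow> bool" where
  "represents g u \<longleftrightarrow> set_integrable lborel {0..2*pi} g \<and>
     (\<forall>f. dist_apply u f = (LBINT x:{0..2*pi}. g x * test_fun f x))"

text \<open>The convention is \<open>f^(k) = 1/(2 pi) * integral over [0, 2 pi] of f(x) exp(-ikx)\<close>, so that
  \<open>f = sum over k of f^(k) exp(ikx)\<close>. A real distribution is paired with \<open>exp(-ikx)\<close> through
  the real and imaginary parts of that function.\<close>

lift_definition cos_test :: "int \<Rightarrow> test" is "\<lambda>k x. cos (of_int k * x)"
proof -
  fix k :: int
  have "cos (of_int k * (x + 2 * pi)) = cos (of_int k * x)" for x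
    using cos_int_2pin[of k] sin_int_2pin[of k] by (simp add: distrib_left cos_add mult_ac)
  then show "smooth_real (\<lambda>x. cos (of_int k * x)) \<and> torus_periodic (\<lambda>x. cos (of_int k * x))"
    using smooth_real_cos[of "of_int k" 0] by (simp add: torus_periodic_def)
qed

lift_definition sin_test :: "int \<Rightarrow> test" is "\<lambda>k x. sin (of_int k * x)"
proof -
  fix k :: int
  have "sin (of_int k * (x + 2 * pi)) = sin (of_int k * x)" for x
    using cos_int_2pin[of k] sin_int_2pin[of k] by (simp add: distrib_left sin_add mult_ac)
  then show "smooth_real (\<lambda>x. sin (of_int k * x)) \<and> torus_periodic (\<lambda>x. sin (of_int k * x))"
    using smooth_real_cos[of "of_int k" "- (pi/2)"] by (simp add: torus_periodic_def cos_diff)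
qed

definition fourier :: "distribution \<Rightarrow> int \<Rightarrow> complex" where
  "fourier u k = Complex (dist_apply u (cos_test k)) (- dist_apply u (sin_test k)) / (2 * pi)"

definition fourier_fun :: "(real \<Rightarrow> real) \<Rightarrow> int \<Rightarrow> complex" where
  "fourier_fun g k = (LBINT x:{0..2*pi}. complex_of_real (g x) * cis (- (of_int k * x))) / (2 * pi)"

definition sobolev :: "real \<Rightarrow> distribution set" where
  "sobolev s = {u. (\<lambda>k::int. (1 + (real_of_int k)\<^sup>2) powr s * (cmod (fourier u k))\<^sup>2) summable_on UNIV}"

definition sobolev_norm :: "real \<Rightarrow> distribution \<Rightarrow> real" where
  "sobolev_norm s u = sqrt (\<Sum>\<^sub>\<infinity>k::int. (1 + (real_of_int k)\<^sup>2) powr s * (cmod (fourier u k))\<^sup>2)"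

definition sobolev_topology :: "real \<Rightarrow> distribution topology" where
  "sobolev_topology s = topology (\<lambda>U. U \<subseteq> sobolev s \<and>
     (\<forall>u\<in>U. \<exists>\<epsilon>>0. \<forall>v\<in>sobolev s. sobolev_norm s (v - u) < \<epsilon> \<longrightarrow> v \<in> U))"

lemma openin_sobolev_topology:
  "openin (sobolev_topology s) U \<longleftrightarrow> U \<subseteq> sobolev s \<and>
     (\<forall>u\<in>U. \<exists>\<epsilon>>0. \<forall>v\<in>sobolev s. sobolev_norm s (v - u) < \<epsilon> \<longrightarrow> v \<in> U)"
proof -
  let ?P = "\<lambda>U. U \<subseteq> sobolev s \<and>
     (\<forall>u\<in>U. \<exists>\<epsilon>>0. \<forall>v\<in>sobolev s. sobolev_norm s (v - u) < \<epsilon> \<longrightarrow> v \<in> U)"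
  have "?P (S \<inter> T)" if S: "?P S" and T: "?P T" for S T
  proof (intro conjI ballI)
    fix u assume "u \<in> S \<inter> T"
    then obtain d e where "d > 0" "e > 0"
      and "\<forall>v\<in>sobolev s. sobolev_norm s (v - u) < d \<longrightarrow> v \<in> S"
      and "\<forall>v\<in>sobolev s. sobolev_norm s (v - u) < e \<longrightarrow> v \<in> T"
      using S T by blast
    then show "\<exists>\<epsilon>>0. \<forall>v\<in>sobolev s. sobolev_norm s (v - u) < \<epsilon> \<longrightarrow> v \<in> S \<inter> T"
      by (intro exI[of _ "min d e"]) auto
  qed (use S in blast)
  moreover have "?P (\<Union>K)" if K: "\<forall>S\<in>K. ?P S" for K
  proof (intro conjI ballI)
    show "\<Union>K \<subseteq> sobolev s"
      using K by blast
    fix u assume "u \<in> \<Union>K"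
    then obtain S where "S \<in> K" "u \<in> S" by blast
    then obtain e where "e > 0" "\<forall>v\<in>sobolev s. sobolev_norm s (v - u) < e \<longrightarrow> v \<in> S"
      using K by meson
    then show "\<exists>\<epsilon>>0. \<forall>v\<in>sobolev s. sobolev_norm s (v - u) < \<epsilon> \<longrightarrow> v \<in> \<Union>K"
      using \<open>S \<in> K\<close> by blast
  qed
  ultimately have "istopology ?P"
    unfolding istopology_def by blast
  then show ?thesis
    by (simp add: sobolev_topology_def topology_inverse')
qed

lemma topspace_sobolev_topology [simp]: "topspace (sobolev_topology s) = sobolev s"
proof
  have "openin (sobolev_topology s) (sobolev s)"
    unfolding openin_sobolev_topology by (auto intro: exI[of _ 1])
  then show "sobolev s \<subseteq> topspace (sobolev_topology s)"
    by (rule openin_subset)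
  show "topspace (sobolev_topology s) \<subseteq> sobolev s"
    using openin_topspace[of "sobolev_topology s"] unfolding openin_sobolev_topology by blast
qed

lemma sobolev_mono:
  assumes "s \<le> r"
  shows "sobolev r \<subseteq> sobolev s"
proof
  fix u assume "u \<in> sobolev r"
  then have sm: "(\<lambda>k::int. (1 + (real_of_int k)\<^sup>2) powr r * (cmod (fourier u k))\<^sup>2) summable_on UNIV"
    by (simp add: sobolev_def)
  show "u \<in> sobolev s"
    unfolding sobolev_def mem_Collect_eq
    by (rule summable_on_comparison_test[OF sm])
       (use assms in \<open>auto intro!: mult_right_mono powr_mono\<close>)
qed

lemma zero_in_sobolev: "0 \<in> sobolev s"
  by (simp add: sobolev_def fourier_def zero_distribution.rep_eq zero_complex.code [symmetric])

lemma topspace_sobolev_subtopology: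
  assumes "s \<le> r"
  shows "topspace (subtopology (sobolev_topology s) (sobolev r)) = sobolev r" "0 \<in> sobolev r"
  using sobolev_mono[OF assms] zero_in_sobolev by auto

definition continuous_sobolev :: "real \<Rightarrow> real set \<Rightarrow> (real \<Rightarrow> distribution) \<Rightarrow> bool" where
  "continuous_sobolev s I u \<longleftrightarrow> (\<forall>t\<in>I. u t \<in> sobolev s) \<and>
     (\<forall>t\<in>I. ((\<lambda>\<tau>. sobolev_norm s (u \<tau> - u t)) \<longlongrightarrow> 0) (at t within I))"

definition kdvb_symbol :: "real \<Rightarrow> int \<Rightarrow> complex" where
  "kdvb_symbol t k = exp (\<i> * of_real (t * of_int k ^ 3) - of_real (t * (of_int k)\<^sup>2))"

text \<open>The integral formulation, read on each Fourier coefficient; \<open>kdvb_symbol t\<close> is the multiplier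
  of \<open>S(t)\<close> and \<open>\<i> k\<close> the one of \<open>d/dx\<close>. For the square to make sense as a distribution, \<open>u\<close> is
  required to be (represented by a function \<open>g\<close>) in \<open>L^2((0,T) \<times> torus)\<close> for all \<open>T\<close>.\<close>

definition integral_solution :: "distribution \<Rightarrow> (real \<Rightarrow> distribution) \<Rightarrow> bool" where
  "integral_solution u0 u \<longleftrightarrow> (\<exists>g :: real \<Rightarrow> real \<Rightarrow> real.
     (\<lambda>(t, x). g t x) \<in> borel_measurable borel \<and>
     (\<forall>T>0. set_integrable lborel ({0..T} \<times> {0..2*pi}) (\<lambda>(t, x). (g t x)\<^sup>2)) \<and>
     (AE t in lborel. t > 0 \<longrightarrow> represents (g t) (u t)) \<and>
     (\<forall>t\<ge>0. \<forall>k. fourier (u t) k = kdvb_symbol t k * fourier u0 k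
        - 1/2 * (LBINT t':{0..t}. kdvb_symbol (t - t') k * (\<i> * of_int k * fourier_fun (\<lambda>x. (g t' x)\<^sup>2) k))))"

text \<open>Classical solutions, smooth on \<open>[0,\<infinity>) \<times> torus\<close> (one-sided in time at \<open>t = 0\<close>);
  \<open>D i j\<close> is the derivative of order \<open>i\<close> in \<open>t\<close> and \<open>j\<close> in \<open>x\<close>.\<close>

definition classical_solution :: "(real \<Rightarrow> real) \<Rightarrow> (real \<Rightarrow> real \<Rightarrow> real) \<Rightarrow> bool" where
  "classical_solution f v \<longleftrightarrow> v 0 = f \<and> (\<forall>t\<ge>0. torus_periodic (v t)) \<and>
     (\<exists>D :: nat \<Rightarrow> nat \<Rightarrow> real \<Rightarrow> real \<Rightarrow> real. D 0 0 = v \<and>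
        (\<forall>i j. continuous_on ({0..} \<times> UNIV) (\<lambda>(t, x). D i j t x)) \<and>
        (\<forall>i j x. \<forall>t\<ge>0. ((\<lambda>\<tau>. D i j \<tau> x) has_real_derivative D (Suc i) j t x) (at t within {0..})) \<and>
        (\<forall>i j x. \<forall>t\<ge>0. (D i j t has_real_derivative D i (Suc j) t x) (at x)) \<and>
        (\<forall>x. \<forall>t\<ge>0. D 1 0 t x + D 0 3 t x - D 0 2 t x + v t x * D 0 1 t x = 0))"

text \<open>Bounded \<open>n\<close>-linear maps from \<open>H^(-1)\<close> to \<open>C([0,T]; H^(-1))\<close>, the latter with the supremum
  norm; only values at lists of \<open>n\<close> elements of \<open>H^(-1)\<close> and at times in \<open>[0,T]\<close> matter.\<close>

definition bounded_multilinear_path ::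
    "real \<Rightarrow> nat \<Rightarrow> real \<Rightarrow> (distribution list \<Rightarrow> real \<Rightarrow> distribution) \<Rightarrow> bool" where
  "bounded_multilinear_path T n B A \<longleftrightarrow> (\<forall>hs. length hs = n \<and> set hs \<subseteq> sobolev (-1) \<longrightarrow>
     continuous_sobolev (-1) {0..T} (A hs) \<and>
     (\<forall>t\<in>{0..T}. sobolev_norm (-1) (A hs t) \<le> B * (\<Prod>h\<leftarrow>hs. sobolev_norm (-1) h)) \<and>
     (\<forall>i<n. \<forall>a b. \<forall>h\<in>sobolev (-1). \<forall>k\<in>sobolev (-1). \<forall>t\<in>{0..T}.
        A (hs[i := a *\<^sub>R h + b *\<^sub>R k]) t = a *\<^sub>R A (hs[i := h]) t + b *\<^sub>R A (hs[i := k]) t))"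

text \<open>Analyticity at \<open>u0\<close> of a map from \<open>H^(-1)\<close> to \<open>C([0,T]; H^(-1))\<close>: expansion into a
  power series of bounded homogeneous polynomials with positive radius of convergence.\<close>

definition analytic_path_at :: "real \<Rightarrow> (distribution \<Rightarrow> real \<Rightarrow> distribution) \<Rightarrow> distribution \<Rightarrow> bool" where
  "analytic_path_at T \<Phi> u0 \<longleftrightarrow> (\<exists>A B. \<exists>r>0.
     (\<forall>n. bounded_multilinear_path T n (B n) (A n)) \<and>
     summable (\<lambda>n. B n * r ^ n) \<and>
     (\<forall>h\<in>sobolev (-1). sobolev_norm (-1) h < r \<longrightarrow>
        uniform_limit {0..T}
          (\<lambda>N t. sobolev_norm (-1) (\<Phi> (u0 + h) t - (\<Sum>n<N. A n (replicate n h) t)))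
          (\<lambda>t. 0) sequentially))"

definition kdvb_flow_map :: "(distribution \<Rightarrow> real \<Rightarrow> distribution) \<Rightarrow> bool" where
  "kdvb_flow_map \<Phi> \<longleftrightarrow>
     (\<forall>u0\<in>sobolev (-1). continuous_sobolev (-1) {0..} (\<Phi> u0) \<and> \<Phi> u0 0 = u0 \<and>
        integral_solution u0 (\<Phi> u0)) \<and>
     (\<forall>u0\<in>sobolev (-1). \<exists>T>0. \<exists>R>0. \<forall>v\<in>sobolev (-1).
        sobolev_norm (-1) (v - u0) < R \<longrightarrow> analytic_path_at T \<Phi> v) \<and>
     (\<forall>f u0. smooth_real f \<and> torus_periodic f \<and> represents f u0 \<longrightarrow>
        (\<exists>v. classical_solution f v \<and> (\<forall>t\<ge>0. represents (v t) (\<Phi> u0 t))))"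

end

theory Submission
  imports Defs
begin

text \<open>The high-frequency data \<open>d\<^sub>N = N cos(N x) + N cos((N + 1) x)\<close> stay in the unit ball of \<open>H^(-1)\<close> and
tend to \<open>0\<close> in \<open>H^s\<close> for \<open>s < -1\<close>. The quadratic term of the equation nevertheless transports a
fixed amount of them to frequency \<open>1 = (N + 1) - N\<close>: the product of the two waves has size \<open>N^2\<close>,
and although the dissipation leaves it only a time of order \<open>1 / N^2\<close> to act, the time integral
\<open>N^2 \<integral> exp(-2M\<tau>) sin(3M\<tau>) d\<tau>\<close> with \<open>M = N (N + 1)\<close> converges to \<open>3/13\<close>. So the second-order
term of \<open>\<epsilon> \<mapsto> \<Phi> (\<epsilon> d\<^sub>N) t\<close> does not vanish as \<open>N\<close> grows, whereas continuity from \<open>H^s\<close> would make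
\<open>\<Phi> (\<epsilon> d\<^sub>N) t\<close> tend to \<open>\<Phi> 0 t\<close>.

To turn this into a proof, everything is tested against one function, \<open>e^t cos(x + t)\<close>, which is
the value at time \<open>t\<close> of the solution \<open>\<psi>(\<tau>, x) = e^\<tau> cos(x + \<tau>)\<close> of the adjoint linear equation.
Along a classical solution \<open>v\<close> the pairing with \<open>\<psi>\<close> has the derivative
\<open>1/2 \<integral> v^2 \<partial>\<^sub>x\<psi> dx\<close> (\<open>pairing_derivative\<close>), so no linear evolution remains to be estimated. For
fixed \<open>N\<close>, an energy estimate bounds the distance in \<open>L^2\<close> of \<open>v\<close> from the linear solution with the
same data \<open>\<epsilon> d\<^sub>N\<close> by a multiple of \<open>\<epsilon>^2\<close> (\<open>perturbation_energy_bound\<close>). Replacing \<open>v^2\<close> by the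
square of the linear solution, where the integral is explicit, yields
\<open>P\<^sub>N(\<epsilon>) = c\<^sub>N \<epsilon>^2 + O(\<epsilon>^3)\<close> for the pairing \<open>P\<^sub>N(\<epsilon>)\<close> at time \<open>t\<close>, with \<open>c\<^sub>N \<ge> \<pi>/26\<close> for large \<open>N\<close>
(\<open>flow_second_order_expansion\<close>, \<open>quadratic_coeff_lower_bound\<close>).

The remainder in this expansion depends badly on \<open>N\<close>, and here analyticity of the flow at the
origin of \<open>H^(-1)\<close> enters. It makes \<open>P\<^sub>N(\<epsilon>)\<close> a power series in \<open>\<epsilon>\<close> whose coefficients are bounded
uniformly in \<open>N\<close> (\<open>analytic_observable_expansion\<close>). The expansion for fixed \<open>N\<close> identifies its first
three coefficients as \<open>0\<close>, \<open>0\<close>, \<open>c\<^sub>N\<close>, and the rest of the series is \<open>O(\<epsilon>^3)\<close> uniformly in \<open>N\<close>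
(\<open>power_series_cubic_remainder\<close>). For one small fixed \<open>\<epsilon>\<close>, therefore, \<open>P\<^sub>N(\<epsilon>) \<ge> (\<pi>/52) \<epsilon>^2\<close> for all
large \<open>N\<close>, while continuity at \<open>0\<close> in \<open>H^s\<close> would force \<open>P\<^sub>N(\<epsilon>) \<rightarrow> 0\<close>.\<close>

section \<open>Integrals over a period and differential inequalities\<close>

lemma periodic_derivative:
  fixes f f' :: "real \<Rightarrow> real"
  assumes "\<And>x. f (x + p) = f x" and "\<And>x. (f has_real_derivative f' x) (at x)"
  shows "f' (x + p) = f' x"
proof -
  have "((\<lambda>x. f (x + p)) has_real_derivative f' (x + p)) (at x)"
    using assms(2)[of "x + p"] by (simp add: DERIV_shift)
  then show ?thesis
    using DERIV_unique[OF _ assms(2)] assms(1) by simp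
qed

text \<open>Energy identities for periodic functions: \<open>R\<close> is the flux, whose derivative integrates to zero over
a period, so only the remaining source \<open>s\<close> contributes to the time derivative of the integral of \<open>Q\<close>.\<close>

lemma DERIV_integral_modulo_divergence:
  fixes Q q :: "real \<Rightarrow> real \<Rightarrow> real" and R s :: "real \<Rightarrow> real"
  assumes Q: "\<And>t x. 0 \<le> t \<Longrightarrow> ((\<lambda>\<tau>. Q \<tau> x) has_real_derivative q t x) (at t within {0..})"
    and Qc: "continuous_on ({0..} \<times> UNIV) (\<lambda>p. Q (fst p) (snd p))"
    and qc: "continuous_on ({0..} \<times> UNIV) (\<lambda>p. q (fst p) (snd p))"
    and R: "\<And>x. (R has_real_derivative q t x - s x) (at x)" "R (2 * pi) = R 0"
    and t: "0 \<le> t"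
  shows "((\<lambda>\<tau>. integral {0..2*pi} (Q \<tau>)) has_real_derivative integral {0..2*pi} s) (at t within {0..})"
proof -
  have slice: "continuous_on {0..2*pi} (g \<tau>)"
    if "continuous_on ({0..} \<times> UNIV) (\<lambda>p. g (fst p) (snd p))" "0 \<le> \<tau>" for g :: "real \<Rightarrow> real \<Rightarrow> real" and \<tau>
    using that by (intro continuous_on_compose2[OF that(1), of _ "\<lambda>x. (\<tau>, x)", simplified])
       (auto intro!: continuous_intros)
  have "((\<lambda>\<tau>. integral (cbox 0 (2*pi)) (Q \<tau>)) has_real_derivative integral (cbox 0 (2*pi)) (q t)) (at t within {0..})"
  proof (rule leibniz_rule_field_derivative)
    show "continuous_on ({0..} \<times> cbox 0 (2 * pi)) (\<lambda>(x, t). q x t)"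
      using qc unfolding case_prod_unfold by (rule continuous_on_subset) auto
  qed (use Q Qc t slice in \<open>auto intro!: integrable_continuous_real\<close>)
  moreover have "((\<lambda>x. q t x - s x) has_integral R (2 * pi) - R 0) {0..2*pi}"
    using R(1) by (intro fundamental_theorem_of_calculus)
      (auto simp: has_real_derivative_iff_has_vector_derivative[symmetric] intro: has_field_derivative_at_within)
  then have "((\<lambda>x. q t x - (q t x - s x)) has_integral integral {0..2*pi} (q t) - 0) {0..2*pi}"
    using R(2) slice[OF qc t] by (intro has_integral_diff integrable_integral integrable_continuous_real) auto
  then have "integral {0..2*pi} s = integral {0..2*pi} (q t)"
    by (simp add: integral_unique)
  ultimately show ?thesis
    by simp
qed

lemma deriv_bound_imp_increment_bound:
  fixes f g :: "real \<Rightarrow> real"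
  assumes "\<And>\<tau>. 0 \<le> \<tau> \<Longrightarrow> (f has_real_derivative g \<tau>) (at \<tau> within {0..})"
    and "\<And>\<tau>. 0 \<le> \<tau> \<Longrightarrow> \<tau> \<le> t \<Longrightarrow> g \<tau> \<le> c" and "0 \<le> t"
  shows "f t - f 0 \<le> c * t"
proof -
  have "f t - c * t \<le> f 0 - c * 0"
  proof (rule DERIV_nonpos_imp_decreasing_open[where f = "\<lambda>\<tau>. f \<tau> - c * \<tau>"])
    have "continuous_on {0..t} f"
      by (rule DERIV_continuous_on, rule DERIV_subset[OF assms(1)]) auto
    then show "continuous_on {0..t} (\<lambda>\<tau>. f \<tau> - c * \<tau>)"
      by (intro continuous_intros)
    fix \<tau> assume \<tau>: "0 < \<tau>" "\<tau> < t"
    then have "(f has_real_derivative g \<tau>) (at \<tau>)"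
      using assms(1)[of \<tau>] at_within_interior[of \<tau> "{0::real..}"] by simp
    then have "((\<lambda>\<tau>. f \<tau> - c * \<tau>) has_real_derivative g \<tau> - c) (at \<tau>)"
      by (auto intro!: derivative_eq_intros)
    then show "\<exists>y. ((\<lambda>\<tau>. f \<tau> - c * \<tau>) has_real_derivative y) (at \<tau>) \<and> y \<le> 0"
      using assms(2)[of \<tau>] \<tau> by fastforce
  qed (use assms in auto)
  then show ?thesis by simp
qed

lemma linear_gronwall:
  fixes E F :: "real \<Rightarrow> real"
  assumes "\<And>\<tau>. 0 \<le> \<tau> \<Longrightarrow> (E has_real_derivative F \<tau>) (at \<tau> within {0..})"
    and "\<And>\<tau>. 0 \<le> \<tau> \<Longrightarrow> F \<tau> \<le> a * E \<tau> + b" and "E 0 = 0" "0 \<le> a" "0 \<le> b" "0 \<le> t"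
  shows "E t \<le> exp (a * t) * b * t"
proof -
  have "exp (- (a * t)) * E t - exp (- (a * 0)) * E 0 \<le> b * t"
  proof (rule deriv_bound_imp_increment_bound)
    fix \<tau> :: real assume \<tau>: "0 \<le> \<tau>"
    show "((\<lambda>\<tau>. exp (- (a * \<tau>)) * E \<tau>) has_real_derivative exp (- (a * \<tau>)) * (F \<tau> - a * E \<tau>)) (at \<tau> within {0..})"
      by (rule derivative_eq_intros assms(1) \<tau> refl | simp add: algebra_simps)+
    have "exp (- (a * \<tau>)) * (F \<tau> - a * E \<tau>) \<le> 1 * b"
    proof (cases "F \<tau> - a * E \<tau> \<ge> 0")
      case True
      then show ?thesis using assms(2)[OF \<tau>] assms(4) \<tau> by (intro mult_mono) auto
    next
      case False
      then have "exp (- (a * \<tau>)) * (F \<tau> - a * E \<tau>) \<le> 0" by (simp add: mult_nonneg_nonpos)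
      then show ?thesis using assms(5) by simp
    qed
    then show "exp (- (a * \<tau>)) * (F \<tau> - a * E \<tau>) \<le> b" by simp
  qed (use assms in auto)
  then have "exp (a * t) * (exp (- (a * t)) * E t) \<le> exp (a * t) * (b * t)"
    using assms(3) by simp
  then show ?thesis
    by (simp add: mult.assoc[symmetric] exp_add[symmetric])
qed

section \<open>Classical solutions and their energy\<close>

text \<open>A periodic solution of \<open>w\<^sub>t + w\<^sub>x\<^sub>x\<^sub>x - w\<^sub>x\<^sub>x + F = 0\<close>, given together with all its \<open>x\<close>-derivatives: \<open>W j\<close> is
the derivative of order \<open>j\<close>. The term \<open>F\<close> is a parameter, so that solutions of the linear equation
(\<open>F = 0\<close>), of the nonlinear one (\<open>F = w w\<^sub>x\<close>) and their differences are treated alike.\<close>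

definition kdvb_jet :: "(nat \<Rightarrow> real \<Rightarrow> real \<Rightarrow> real) \<Rightarrow> (real \<Rightarrow> real \<Rightarrow> real) \<Rightarrow> bool" where
  "kdvb_jet W F \<longleftrightarrow>
     (\<forall>j. continuous_on ({0..} \<times> UNIV) (\<lambda>p. W j (fst p) (snd p))) \<and>
     continuous_on ({0..} \<times> UNIV) (\<lambda>p. F (fst p) (snd p)) \<and>
     (\<forall>j x. \<forall>t\<ge>0. W j t (x + 2 * pi) = W j t x) \<and>
     (\<forall>j x. \<forall>t\<ge>0. (W j t has_real_derivative W (Suc j) t x) (at x)) \<and>
     (\<forall>x. \<forall>t\<ge>0. ((\<lambda>\<tau>. W 0 \<tau> x) has_real_derivative W 2 t x - W 3 t x - F t x) (at t within {0..}))"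

lemma kdvb_jetD:
  assumes "kdvb_jet W F"
  shows "continuous_on ({0..} \<times> UNIV) (\<lambda>p. W j (fst p) (snd p))"
    and "continuous_on ({0..} \<times> UNIV) (\<lambda>p. F (fst p) (snd p))"
    and "0 \<le> t \<Longrightarrow> W j t (x + 2 * pi) = W j t x"
    and "0 \<le> t \<Longrightarrow> (W j t has_real_derivative W (Suc j) t x) (at x)"
    and "0 \<le> t \<Longrightarrow> ((\<lambda>\<tau>. W 0 \<tau> x) has_real_derivative W 2 t x - W 3 t x - F t x) (at t within {0..})"
  using assms by (simp_all add: kdvb_jet_def)

lemma kdvb_jet_lincomb:
  assumes "kdvb_jet V F" "kdvb_jet W G"
  shows "kdvb_jet (\<lambda>j t x. a * V j t x + b * W j t x) (\<lambda>t x. a * F t x + b * G t x)"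
  unfolding kdvb_jet_def
proof (intro conjI allI impI)
  fix t x :: real and j assume t: "0 \<le> t"
  from DERIV_add[OF DERIV_cmult[OF kdvb_jetD(5)[OF assms(1) t, of x], of a]
      DERIV_cmult[OF kdvb_jetD(5)[OF assms(2) t, of x], of b]]
  show "((\<lambda>\<tau>. a * V 0 \<tau> x + b * W 0 \<tau> x) has_real_derivative
          a * V 2 t x + b * W 2 t x - (a * V 3 t x + b * W 3 t x) - (a * F t x + b * G t x)) (at t within {0..})"
    by (simp add: algebra_simps)
  show "((\<lambda>x. a * V j t x + b * W j t x) has_real_derivative a * V (Suc j) t x + b * W (Suc j) t x) (at x)"
    by (intro DERIV_add DERIV_cmult kdvb_jetD(4)[OF assms(1) t] kdvb_jetD(4)[OF assms(2) t])
  show "a * V j t (x + 2 * pi) + b * W j t (x + 2 * pi) = a * V j t x + b * W j t x"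
    using t by (simp add: kdvb_jetD(3)[OF assms(1)] kdvb_jetD(3)[OF assms(2)])
qed (intro continuous_on_add continuous_on_mult continuous_on_const kdvb_jetD(1,2)[OF assms(1)] kdvb_jetD(1,2)[OF assms(2)])+

lemma classical_solution_jet:
  assumes "classical_solution f v"
  obtains V where "kdvb_jet V (\<lambda>t x. V 0 t x * V 1 t x)" "V 0 = v"
proof -
  obtain D :: "nat \<Rightarrow> nat \<Rightarrow> real \<Rightarrow> real \<Rightarrow> real" where D: "D 0 0 = v"
      "\<And>i j. continuous_on ({0..} \<times> UNIV) (\<lambda>p. D i j (fst p) (snd p))"
      "\<And>i j x t. 0 \<le> t \<Longrightarrow> ((\<lambda>\<tau>. D i j \<tau> x) has_real_derivative D (Suc i) j t x) (at t within {0..})"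
      "\<And>i j x t. 0 \<le> t \<Longrightarrow> (D i j t has_real_derivative D i (Suc j) t x) (at x)"
      "\<And>x t. 0 \<le> t \<Longrightarrow> D 1 0 t x + D 0 3 t x - D 0 2 t x + v t x * D 0 1 t x = 0"
    using assms unfolding classical_solution_def case_prod_unfold by blast
  have per: "D 0 j t (x + 2 * pi) = D 0 j t x" if "0 \<le> t" for j t x
  proof (induction j arbitrary: x)
    case 0
    then show ?case using assms that D(1) by (auto simp: classical_solution_def torus_periodic_def)
  next
    case (Suc j)
    show ?case
      by (rule periodic_derivative[of "D 0 j t" _ "D 0 (Suc j) t", OF Suc D(4)[OF that]])
  qed
  have "kdvb_jet (D 0) (\<lambda>t x. D 0 0 t x * D 0 1 t x)"
    unfolding kdvb_jet_def
  proof (intro conjI allI impI)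
    fix t x :: real assume t: "0 \<le> t"
    have "D 0 2 t x - D 0 3 t x - D 0 0 t x * D 0 1 t x = D (Suc 0) 0 t x"
      using D(5)[OF t, of x] D(1) by simp
    then show "((\<lambda>\<tau>. D 0 0 \<tau> x) has_real_derivative D 0 2 t x - D 0 3 t x - D 0 0 t x * D 0 1 t x) (at t within {0..})"
      using D(3)[OF t] by metis
  qed (intro D(2,4) per continuous_on_mult; assumption)+
  then show ?thesis using D(1) that by blast
qed

text \<open>The difference \<open>w = v - l\<close> of a nonlinear and a linear solution with equal data satisfies
\<open>d/dt \<integral> w^2 = \<integral> (-2 w\<^sub>x^2 - w^2 l\<^sub>x - 2 w l l\<^sub>x)\<close>: every other term is an \<open>x\<close>-derivative. The source
\<open>l l\<^sub>x\<close> is quadratic in the size \<open>\<delta>\<close> of the data, so the Gronwall inequality gives \<open>\<integral> w^2 = O(\<delta>^4)\<close>.\<close>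

lemma perturbation_energy_bound:
  assumes V: "kdvb_jet V (\<lambda>t x. V 0 t x * V 1 t x)" and l: "kdvb_jet l (\<lambda>t x. 0)"
    and bd: "\<And>j t x. 0 \<le> t \<Longrightarrow> j \<le> 1 \<Longrightarrow> \<bar>l j t x\<bar> \<le> \<delta>"
    and init: "\<And>x. V 0 0 x = l 0 0 x" and t: "0 \<le> t"
  shows "integral {0..2*pi} (\<lambda>x. (V 0 t x - l 0 t x)\<^sup>2) \<le> exp ((1 + \<delta>) * t) * (2 * pi * \<delta> ^ 4) * t"
proof -
  define W where "W = (\<lambda>j t x. V j t x - l j t x)"
  have W: "kdvb_jet W (\<lambda>t x. (l 0 t x + W 0 t x) * (l 1 t x + W 1 t x))"
    using kdvb_jet_lincomb[OF V l, of 1 "-1"] by (simp add: W_def)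
  let ?E = "\<lambda>\<tau>. integral {0..2*pi} (\<lambda>x. (W 0 \<tau> x)\<^sup>2)"
  let ?s = "\<lambda>\<tau> x. - 2 * (W 1 \<tau> x)\<^sup>2 - (W 0 \<tau> x)\<^sup>2 * l 1 \<tau> x - 2 * W 0 \<tau> x * l 0 \<tau> x * l 1 \<tau> x"
  let ?q = "\<lambda>\<tau> x. 2 * W 0 \<tau> x * (W 2 \<tau> x - W 3 \<tau> x - (l 0 \<tau> x + W 0 \<tau> x) * (l 1 \<tau> x + W 1 \<tau> x))"
  note [continuous_intros] = kdvb_jetD(1)[OF W] kdvb_jetD(1)[OF l]
  have \<delta>: "0 \<le> \<delta>" using bd[of 0 0 0] by (smt (verit) zero_le_one)
  have dE: "(?E has_real_derivative integral {0..2*pi} (?s \<tau>)) (at \<tau> within {0..})"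
    if \<tau>: "0 \<le> \<tau>" for \<tau>
  proof (rule DERIV_integral_modulo_divergence[where q = ?q and
      R = "\<lambda>x. - 2 * W 0 \<tau> x * W 2 \<tau> x + (W 1 \<tau> x)\<^sup>2 + 2 * W 0 \<tau> x * W 1 \<tau> x
                - 2 / 3 * W 0 \<tau> x ^ 3 - l 0 \<tau> x * (W 0 \<tau> x)\<^sup>2"])
    show "((\<lambda>\<tau>. (W 0 \<tau> x)\<^sup>2) has_real_derivative ?q t x) (at t within {0..})" if "0 \<le> t" for t x
      by (rule derivative_eq_intros kdvb_jetD(5)[OF W that] refl)+ simp
    note W' = kdvb_jetD(4)[OF W \<tau>]
    show "((\<lambda>x. - 2 * W 0 \<tau> x * W 2 \<tau> x + (W 1 \<tau> x)\<^sup>2 + 2 * W 0 \<tau> x * W 1 \<tau> x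
                - 2 / 3 * W 0 \<tau> x ^ 3 - l 0 \<tau> x * (W 0 \<tau> x)\<^sup>2) has_real_derivative ?q \<tau> x - ?s \<tau> x) (at x)" for x
      by (rule derivative_eq_intros W' kdvb_jetD(4)[OF l \<tau>] refl)+
         (simp add: eval_nat_numeral algebra_simps)
  qed (use \<tau> kdvb_jetD(3)[OF W \<tau>, of _ 0] kdvb_jetD(3)[OF l \<tau>, of _ 0] in \<open>auto intro!: continuous_intros\<close>)
  have le: "integral {0..2*pi} (?s \<tau>) \<le> (1 + \<delta>) * integral {0..2*pi} (\<lambda>x. (W 0 \<tau> x)\<^sup>2) + 2 * pi * \<delta> ^ 4"
    if \<tau>: "0 \<le> \<tau>" for \<tau>
  proof -
    have slice: "continuous_on {0..2*pi} (g \<tau>)"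
      if "continuous_on ({0..} \<times> UNIV) (\<lambda>p. g (fst p) (snd p))" for g :: "real \<Rightarrow> real \<Rightarrow> real"
      using that \<tau> by (intro continuous_on_compose2[OF that(1), of _ "\<lambda>x. (\<tau>, x)", simplified])
         (auto intro!: continuous_intros)
    have "integral {0..2*pi} (?s \<tau>) \<le> integral {0..2*pi} (\<lambda>x. (1 + \<delta>) * (W 0 \<tau> x)\<^sup>2 + \<delta> ^ 4)"
    proof (rule integral_le)
      show "?s \<tau> x \<le> (1 + \<delta>) * (W 0 \<tau> x)\<^sup>2 + \<delta> ^ 4" for x
      proof -
        have b: "\<bar>l 0 \<tau> x\<bar> \<le> \<delta>" "\<bar>l 1 \<tau> x\<bar> \<le> \<delta>" using bd \<tau> by auto
        have "- l 1 \<tau> x * (W 0 \<tau> x)\<^sup>2 \<le> \<delta> * (W 0 \<tau> x)\<^sup>2"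
          using b by (intro mult_right_mono) auto
        moreover have "- 2 * W 0 \<tau> x * (l 0 \<tau> x * l 1 \<tau> x) \<le> (W 0 \<tau> x)\<^sup>2 + (l 0 \<tau> x * l 1 \<tau> x)\<^sup>2"
          using zero_le_power2[of "W 0 \<tau> x + l 0 \<tau> x * l 1 \<tau> x"] by (simp add: power2_sum)
        moreover have "(l 0 \<tau> x * l 1 \<tau> x)\<^sup>2 \<le> (\<delta> * \<delta>)\<^sup>2"
          using b by (intro power2_le_iff_abs_le[THEN iffD2]) (auto simp: abs_mult intro!: mult_mono)
        moreover have "(\<delta> * \<delta>)\<^sup>2 = \<delta> ^ 4" by (simp add: eval_nat_numeral)
        ultimately show ?thesis by (simp add: algebra_simps) (smt (verit) zero_le_power2)
      qed
    qed (auto intro!: integrable_continuous_real continuous_intros slice)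
    also have "\<dots> = (1 + \<delta>) * integral {0..2*pi} (\<lambda>x. (W 0 \<tau> x)\<^sup>2) + 2 * pi * \<delta> ^ 4"
      by (subst integral_add) (auto intro!: integrable_continuous_real continuous_intros slice)
    finally show ?thesis .
  qed
  have "?E t \<le> exp ((1 + \<delta>) * t) * (2 * pi * \<delta> ^ 4) * t"
    by (rule linear_gronwall[OF dE le]) (use \<delta> t init in \<open>auto simp: W_def\<close>)
  then show ?thesis by (simp add: W_def)
qed

section \<open>Explicit solutions of the linear equation and of its adjoint\<close>

text \<open>The \<open>x\<close>-derivative of order \<open>j\<close> of \<open>e^\<tau> cos(x + \<tau>)\<close>, the solution of frequency \<open>1\<close> of the adjoint
equation \<open>\<psi>\<^sub>\<tau> + \<psi>\<^sub>x\<^sub>x\<^sub>x + \<psi>\<^sub>x\<^sub>x = 0\<close>. Each derivative of a cosine is a shift of its phase by \<open>\<pi>/2\<close>.\<close>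

definition backward_wave :: "nat \<Rightarrow> real \<Rightarrow> real \<Rightarrow> real" where
  "backward_wave j \<tau> x = exp \<tau> * cos (x + \<tau> + real j * (pi / 2))"

lemma cos_quarter_turns:
  "cos (y + 1 * (pi / 2)) = - sin y" "cos (y + 2 * (pi / 2)) = - cos y" "cos (y + 3 * (pi / 2)) = sin y"
  for y :: real
proof -
  have "y + 3 * (pi / 2) = y + pi / 2 + pi" by (simp add: field_simps)
  then show "cos (y + 3 * (pi / 2)) = sin y" by (simp only: cos_add) simp
qed (simp_all add: cos_add)

lemma cos_Suc_quarter_turn: "cos (y + real (Suc j) * (pi / 2)) = - sin (y + real j * (pi / 2))"
proof -
  have "y + real (Suc j) * (pi / 2) = y + real j * (pi / 2) + pi / 2" by (simp add: field_simps)
  then show ?thesis by (simp only: cos_add) simp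
qed

lemma backward_wave_deriv_x:
  "(backward_wave j \<tau> has_real_derivative backward_wave (Suc j) \<tau> x) (at x)"
  unfolding backward_wave_def cos_Suc_quarter_turn
  by (auto intro!: derivative_eq_intros)

lemma backward_wave_deriv_t:
  "((\<lambda>\<tau>. backward_wave 0 \<tau> x) has_real_derivative - backward_wave 3 \<tau> x - backward_wave 2 \<tau> x) (at \<tau> within S)"
  unfolding backward_wave_def of_nat_numeral cos_quarter_turns
  by (auto intro!: derivative_eq_intros simp: algebra_simps)

lemma backward_wave_periodic: "backward_wave j \<tau> (x + 2 * pi) = backward_wave j \<tau> x"
proof -
  have "x + 2 * pi + \<tau> + real j * (pi / 2) = x + \<tau> + real j * (pi / 2) + 2 * pi" by simp
  then show ?thesis by (simp only: backward_wave_def cos_periodic)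
qed

lemma continuous_backward_wave:
  "continuous_on S (\<lambda>p. backward_wave j (fst p) (snd p))"
  unfolding backward_wave_def by (intro continuous_intros)

text \<open>Since the backward wave solves the adjoint equation, integration by parts leaves nothing of the
linear part; the nonlinearity \<open>- v v\<^sub>x = - (v^2)\<^sub>x / 2\<close> contributes the right-hand side.\<close>

lemma pairing_derivative:
  assumes V: "kdvb_jet V (\<lambda>t x. V 0 t x * V 1 t x)" and \<tau>: "0 \<le> \<tau>"
  shows "((\<lambda>\<tau>. integral {0..2*pi} (\<lambda>x. V 0 \<tau> x * backward_wave 0 \<tau> x)) has_real_derivative
            integral {0..2*pi} (\<lambda>x. 1/2 * (V 0 \<tau> x)\<^sup>2 * backward_wave 1 \<tau> x)) (at \<tau> within {0..})"
proof -
  note [continuous_intros] = kdvb_jetD(1)[OF V] continuous_backward_wave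
  let ?p = backward_wave
  let ?q = "\<lambda>\<tau> x. (V 2 \<tau> x - V 3 \<tau> x - V 0 \<tau> x * V 1 \<tau> x) * ?p 0 \<tau> x + V 0 \<tau> x * (- ?p 3 \<tau> x - ?p 2 \<tau> x)"
  show ?thesis
  proof (rule DERIV_integral_modulo_divergence[where q = ?q and
      R = "\<lambda>x. - V 2 \<tau> x * ?p 0 \<tau> x + V 1 \<tau> x * ?p 1 \<tau> x - V 0 \<tau> x * ?p 2 \<tau> x
             + V 1 \<tau> x * ?p 0 \<tau> x - V 0 \<tau> x * ?p 1 \<tau> x - 1/2 * (V 0 \<tau> x)\<^sup>2 * ?p 0 \<tau> x"])
    show "((\<lambda>\<tau>. V 0 \<tau> x * ?p 0 \<tau> x) has_real_derivative ?q t x) (at t within {0..})" if "0 \<le> t" for t x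
      by (rule derivative_eq_intros kdvb_jetD(5)[OF V that] backward_wave_deriv_t refl)+ simp
    note V' = kdvb_jetD(4)[OF V \<tau>]
    show "((\<lambda>x. - V 2 \<tau> x * ?p 0 \<tau> x + V 1 \<tau> x * ?p 1 \<tau> x - V 0 \<tau> x * ?p 2 \<tau> x
             + V 1 \<tau> x * ?p 0 \<tau> x - V 0 \<tau> x * ?p 1 \<tau> x - 1/2 * (V 0 \<tau> x)\<^sup>2 * ?p 0 \<tau> x) has_real_derivative
           ?q \<tau> x - 1/2 * (V 0 \<tau> x)\<^sup>2 * ?p 1 \<tau> x) (at x)" for x
      by (rule derivative_eq_intros V' backward_wave_deriv_x refl)+
         (simp add: eval_nat_numeral algebra_simps)
  qed (use \<tau> kdvb_jetD(3)[OF V \<tau>, of _ 0] backward_wave_periodic[of _ _ 0] in \<open>auto intro!: continuous_intros\<close>)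
qed

text \<open>The \<open>x\<close>-derivative of order \<open>j\<close> of \<open>exp(-k^2 t) cos(k x + k^3 t)\<close>, the solution of the linear
equation with initial value \<open>cos(k x)\<close>.\<close>

definition wave :: "nat \<Rightarrow> nat \<Rightarrow> real \<Rightarrow> real \<Rightarrow> real" where
  "wave k j t x = real k ^ j * exp (- ((real k)\<^sup>2 * t)) * cos (real k * x + real k ^ 3 * t + real j * (pi / 2))"

lemma wave_jet: "kdvb_jet (wave k) (\<lambda>t x. 0)"
  unfolding kdvb_jet_def
proof (intro conjI allI impI)
  fix j :: nat and t x :: real
  have "real k * (x + 2 * pi) + real k ^ 3 * t + real j * (pi / 2)
      = real k * x + real k ^ 3 * t + real j * (pi / 2) + 2 * real k * pi"
    by (simp add: algebra_simps)
  then show "wave k j t (x + 2 * pi) = wave k j t x"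
    using cos_int_2pin[of "int k"] sin_int_2pin[of "int k"] by (simp only: wave_def cos_add) (simp add: mult_ac)
  show "(wave k j t has_real_derivative wave k (Suc j) t x) (at x)"
    unfolding wave_def cos_Suc_quarter_turn by (auto intro!: derivative_eq_intros)
  show "((\<lambda>\<tau>. wave k 0 \<tau> x) has_real_derivative wave k 2 t x - wave k 3 t x - 0) (at t within {0..})"
    unfolding wave_def of_nat_numeral cos_quarter_turns
    by (auto intro!: derivative_eq_intros simp: algebra_simps)
qed (auto simp: wave_def intro!: continuous_intros)

lemma abs_wave_le:
  assumes "0 \<le> t"
  shows "\<bar>wave k j t x\<bar> \<le> real k ^ j"
proof -
  have "exp (- ((real k)\<^sup>2 * t)) * \<bar>cos (real k * x + real k ^ 3 * t + real j * (pi / 2))\<bar> \<le> 1 * 1"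
    using assms by (intro mult_mono) auto
  then have "real k ^ j * (exp (- ((real k)\<^sup>2 * t)) * \<bar>cos (real k * x + real k ^ 3 * t + real j * (pi / 2))\<bar>) \<le> real k ^ j * 1"
    by (intro mult_left_mono) auto
  then show ?thesis by (simp add: wave_def abs_mult mult_ac)
qed

section \<open>The resonant pair of waves\<close>

lemma has_integral_sin_period:
  assumes "k \<in> \<int>" "k \<noteq> 0"
  shows "((\<lambda>x. sin (k * x + c)) has_integral 0) {0..2*pi}"
proof -
  have "((\<lambda>x. sin (k * x + c)) has_integral - cos (k * (2 * pi) + c) / k - (- cos (k * 0 + c) / k)) {0..2*pi}"
    using assms by (intro fundamental_theorem_of_calculus)
      (auto simp: has_real_derivative_iff_has_vector_derivative[symmetric] intro!: derivative_eq_intros)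
  moreover obtain n where "k = of_int n"
    using assms(1) by (auto elim: Ints_cases)
  then have "cos (k * (2 * pi) + c) = cos c"
    using cos_int_2pin[of n] sin_int_2pin[of n] by (simp add: cos_add mult_ac)
  ultimately show ?thesis by simp
qed

definition pair_wave :: "nat \<Rightarrow> nat \<Rightarrow> real \<Rightarrow> real \<Rightarrow> real" where
  "pair_wave N j t x = real N * wave N j t x + real N * wave (Suc N) j t x"

lemma pair_wave_jet: "kdvb_jet (pair_wave N) (\<lambda>t x. 0)"
  using kdvb_jet_lincomb[OF wave_jet wave_jet, of "real N" N "real N" "Suc N"]
  unfolding pair_wave_def[abs_def] by simp

text \<open>One bound for the function and for its first derivative, as needed for the energy estimate.\<close>

lemma abs_pair_wave_le:
  assumes "0 \<le> t" "j \<le> 1"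
  shows "\<bar>pair_wave N j t x\<bar> \<le> 2 * real N * (real N + 1)"
proof -
  have "\<bar>wave k j t x\<bar> \<le> real N + 1" if "k = N \<or> k = Suc N" for k
    using abs_wave_le[OF assms(1), of k j x] that assms(2) by (cases j) auto
  then have "real N * \<bar>wave N j t x\<bar> + real N * \<bar>wave (Suc N) j t x\<bar> \<le> real N * (real N + 1) + real N * (real N + 1)"
    by (intro add_mono mult_left_mono) auto
  moreover have "\<bar>pair_wave N j t x\<bar> \<le> real N * \<bar>wave N j t x\<bar> + real N * \<bar>wave (Suc N) j t x\<bar>"
    unfolding pair_wave_def by (rule order_trans[OF abs_triangle_ineq]) (simp add: abs_mult)
  ultimately show ?thesis by (simp add: algebra_simps)
qed

text \<open>With \<open>a\<close> and \<open>b\<close> the phases of the two waves and \<open>y\<close> that of the backward wave, \<open>b - a - y\<close> is the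
only combination of phases on the right-hand side that does not depend on \<open>x\<close>, whence its position
at the end.\<close>

lemma square_of_two_cosines_times_sine:
  fixes a b y A B :: real
  shows "- (A * cos a + B * cos b)\<^sup>2 * sin y =
    (- (A\<^sup>2 + B\<^sup>2) / 2 * sin y - A\<^sup>2 / 4 * sin (2 * a + y) + A\<^sup>2 / 4 * sin (2 * a - y)
       - B\<^sup>2 / 4 * sin (2 * b + y) + B\<^sup>2 / 4 * sin (2 * b - y)
       - A * B / 2 * sin (a + b + y) + A * B / 2 * sin (a + b - y)
       - A * B / 2 * sin (b - a + y)) + A * B / 2 * sin (b - a - y)"
proof -
  have c: "sin (z + y) - sin (z - y) = 2 * cos z * sin y" for z
    by (simp add: sin_add sin_diff)
  have d: "cos (a + b) + cos (b - a) = 2 * cos a * cos b" "cos (2 * a) = 2 * (cos a)\<^sup>2 - 1" "cos (2 * b) = 2 * (cos b)\<^sup>2 - 1"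
    by (simp_all add: cos_add cos_diff cos_double_cos)
  have "(A * cos a + B * cos b)\<^sup>2 = A\<^sup>2 * (cos a)\<^sup>2 + B\<^sup>2 * (cos b)\<^sup>2 + A * B * (2 * cos a * cos b)"
    by (simp add: power2_sum power_mult_distrib algebra_simps)
  also have "\<dots> = A\<^sup>2 * ((1 + cos (2 * a)) / 2) + B\<^sup>2 * ((1 + cos (2 * b)) / 2) + A * B * (cos (a + b) + cos (b - a))"
    by (simp only: d) (simp add: field_simps)
  finally have square: "(A * cos a + B * cos b)\<^sup>2 = A\<^sup>2 * ((1 + cos (2 * a)) / 2) + B\<^sup>2 * ((1 + cos (2 * b)) / 2) + A * B * (cos (a + b) + cos (b - a))" .
  have "- (A * cos a + B * cos b)\<^sup>2 * sin y =
     - (A\<^sup>2 + B\<^sup>2) / 2 * sin y - A\<^sup>2 / 4 * (2 * cos (2 * a) * sin y) - B\<^sup>2 / 4 * (2 * cos (2 * b) * sin y)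
     - A * B / 2 * (2 * cos (a + b) * sin y) - A * B / 2 * (2 * cos (b - a) * sin y)"
    unfolding square by (simp add: field_simps)
  then show ?thesis
    unfolding c[symmetric] by (simp add: algebra_simps)
qed

text \<open>The pairing of the backward wave with the square of the linear solution. Of the product of the
three waves only the part independent of \<open>x\<close> survives the integration. Its phase is
\<open>((N + 1)^3 - N^3 - 1) \<tau> = 3 N (N + 1) \<tau>\<close>, and its decay rate is
\<open>N^2 + (N + 1)^2 - 1 = 2 N (N + 1)\<close>, the \<open>- 1\<close> coming from the growth of the backward wave.\<close>

lemma low_frequency_source:
  assumes "1 \<le> N"
  shows "integral {0..2*pi} (\<lambda>x. 1/2 * (pair_wave N 0 \<tau> x)\<^sup>2 * backward_wave 1 \<tau> x)
       = pi / 2 * (real N)\<^sup>2 * (exp (- (2 * (real N * (real N + 1)) * \<tau>)) * sin (3 * (real N * (real N + 1)) * \<tau>))"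
proof -
  let ?n = "real N"
  define A B where AB: "A = exp (- (?n\<^sup>2 * \<tau>))" "B = exp (- ((?n + 1)\<^sup>2 * \<tau>))"
  define f where "f = (\<lambda>x. (- (A\<^sup>2 + B\<^sup>2) / 2 * sin (real 1 * x + \<tau>)
       - A\<^sup>2 / 4 * sin (real (2 * N + 1) * x + (2 * ?n ^ 3 + 1) * \<tau>)
       + A\<^sup>2 / 4 * sin (real (2 * N - 1) * x + (2 * ?n ^ 3 - 1) * \<tau>)
       - B\<^sup>2 / 4 * sin (real (2 * N + 3) * x + (2 * (?n + 1) ^ 3 + 1) * \<tau>)
       + B\<^sup>2 / 4 * sin (real (2 * N + 1) * x + (2 * (?n + 1) ^ 3 - 1) * \<tau>)
       - A * B / 2 * sin (real (2 * N + 2) * x + (?n ^ 3 + (?n + 1) ^ 3 + 1) * \<tau>)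
       + A * B / 2 * sin (real (2 * N) * x + (?n ^ 3 + (?n + 1) ^ 3 - 1) * \<tau>)
       - A * B / 2 * sin (real 2 * x + ((?n + 1) ^ 3 - ?n ^ 3 + 1) * \<tau>)) + A * B / 2 * sin (3 * (?n * (?n + 1)) * \<tau>))"
  have "(f has_integral (- (A\<^sup>2 + B\<^sup>2) / 2 * 0 - A\<^sup>2 / 4 * 0 + A\<^sup>2 / 4 * 0 - B\<^sup>2 / 4 * 0 + B\<^sup>2 / 4 * 0
          - A * B / 2 * 0 + A * B / 2 * 0 - A * B / 2 * 0) + measure lborel {0..2*pi} *\<^sub>R (A * B / 2 * sin (3 * (?n * (?n + 1)) * \<tau>))) {0..2*pi}"
    unfolding f_def
    by (intro has_integral_add has_integral_diff has_integral_mult_right has_integral_sin_period has_integral_const_real)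
       (use assms in auto)
  then have "((\<lambda>x. ?n\<^sup>2 * exp \<tau> / 2 * f x) has_integral ?n\<^sup>2 * exp \<tau> / 2 * (pi * (A * B * sin (3 * (?n * (?n + 1)) * \<tau>)))) {0..2*pi}"
    by (intro has_integral_mult_right) (simp add: mult.assoc)
  moreover have "1/2 * (pair_wave N 0 \<tau> x)\<^sup>2 * backward_wave 1 \<tau> x = ?n\<^sup>2 * exp \<tau> / 2 * f x" for x
  proof -
    let ?a = "?n * x + ?n ^ 3 * \<tau>" and ?b = "(?n + 1) * x + (?n + 1) ^ 3 * \<tau>" and ?y = "x + \<tau>"
    have "real (2 * N - 1) = 2 * ?n - 1" using assms by simp
    then have args: "real 1 * x + \<tau> = ?y"
      "real (2 * N + 1) * x + (2 * ?n ^ 3 + 1) * \<tau> = 2 * ?a + ?y"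
      "real (2 * N - 1) * x + (2 * ?n ^ 3 - 1) * \<tau> = 2 * ?a - ?y"
      "real (2 * N + 3) * x + (2 * (?n + 1) ^ 3 + 1) * \<tau> = 2 * ?b + ?y"
      "real (2 * N + 1) * x + (2 * (?n + 1) ^ 3 - 1) * \<tau> = 2 * ?b - ?y"
      "real (2 * N + 2) * x + (?n ^ 3 + (?n + 1) ^ 3 + 1) * \<tau> = ?a + ?b + ?y"
      "real (2 * N) * x + (?n ^ 3 + (?n + 1) ^ 3 - 1) * \<tau> = ?a + ?b - ?y"
      "real 2 * x + ((?n + 1) ^ 3 - ?n ^ 3 + 1) * \<tau> = ?b - ?a + ?y"
      "3 * (?n * (?n + 1)) * \<tau> = ?b - ?a - ?y"
      by (simp_all add: algebra_simps power3_eq_cube)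
    have "f x = - (A * cos ?a + B * cos ?b)\<^sup>2 * sin ?y"
      unfolding f_def args by (rule square_of_two_cosines_times_sine[symmetric])
    moreover have "pair_wave N 0 \<tau> x = ?n * (A * cos ?a + B * cos ?b)"
      by (simp add: pair_wave_def wave_def AB algebra_simps)
    moreover have "backward_wave 1 \<tau> x = - exp \<tau> * sin ?y"
      by (simp only: backward_wave_def of_nat_1 cos_quarter_turns mult_minus_left mult_minus_right)
    ultimately show ?thesis
      by (simp add: power_mult_distrib)
  qed
  moreover have "exp \<tau> * (A * B) = exp (- (2 * (?n * (?n + 1)) * \<tau>))"
    unfolding AB exp_add[symmetric] by (rule arg_cong[of _ _ exp]) (simp add: algebra_simps power2_eq_square)
  moreover have "?n\<^sup>2 * exp \<tau> / 2 * (pi * (A * B * sin z)) = pi / 2 * ?n\<^sup>2 * (exp \<tau> * (A * B) * sin z)" for z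
    by simp
  ultimately show ?thesis
    by (simp only: integral_unique)
qed

text \<open>For \<open>N \<ge> 2\<close> the data have no component of frequency \<open>1\<close>, so the linear term of the expansion
vanishes.\<close>

lemma pair_wave_initial_pairing:
  assumes "2 \<le> N"
  shows "integral {0..2*pi} (\<lambda>x. pair_wave N 0 0 x * backward_wave 0 0 x) = 0"
proof -
  let ?n = "real N"
  have "((\<lambda>x. ?n / 2 * sin (real (N + 1) * x + pi / 2) + ?n / 2 * sin (real (N - 1) * x + pi / 2)
            + ?n / 2 * sin (real (N + 2) * x + pi / 2) + ?n / 2 * sin (real N * x + pi / 2)) has_integral
           (?n / 2 * 0 + ?n / 2 * 0 + ?n / 2 * 0 + ?n / 2 * 0)) {0..2*pi}"
    using assms by (intro has_integral_add has_integral_mult_right has_integral_sin_period) auto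
  moreover have "?n / 2 * sin (real (N + 1) * x + pi / 2) + ?n / 2 * sin (real (N - 1) * x + pi / 2)
            + ?n / 2 * sin (real (N + 2) * x + pi / 2) + ?n / 2 * sin (real N * x + pi / 2)
          = pair_wave N 0 0 x * backward_wave 0 0 x" for x
  proof -
    have a: "real (N + 1) * x + pi / 2 = (?n * x + x) + pi / 2" "real (N - 1) * x + pi / 2 = (?n * x - x) + pi / 2"
      "real (N + 2) * x + pi / 2 = ((?n + 1) * x + x) + pi / 2" "?n * x + pi / 2 = ((?n + 1) * x - x) + pi / 2"
      using assms by (simp_all add: algebra_simps of_nat_diff)
    have "sin (z + pi / 2) = cos z" for z :: real by (simp add: sin_add)
    moreover have "cos (z + x) + cos (z - x) = 2 * (cos z * cos x)" for z by (simp add: cos_add cos_diff)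
    ultimately have s: "sin (z + x + pi / 2) + sin (z - x + pi / 2) = 2 * (cos z * cos x)" for z by simp
    have "?n / 2 * sin (real (N + 1) * x + pi / 2) + ?n / 2 * sin (real (N - 1) * x + pi / 2)
            + ?n / 2 * sin (real (N + 2) * x + pi / 2) + ?n / 2 * sin (real N * x + pi / 2)
        = ?n / 2 * (sin (?n * x + x + pi / 2) + sin (?n * x - x + pi / 2))
          + ?n / 2 * (sin ((?n + 1) * x + x + pi / 2) + sin ((?n + 1) * x - x + pi / 2))"
      unfolding a by (simp only: distrib_left add.assoc)
    also have "\<dots> = ?n * cos (?n * x) * cos x + ?n * cos ((?n + 1) * x) * cos x"
      unfolding s by simp
    also have "\<dots> = pair_wave N 0 0 x * backward_wave 0 0 x"
      by (simp add: pair_wave_def wave_def backward_wave_def algebra_simps)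
    finally show ?thesis .
  qed
  ultimately show ?thesis by (simp add: integral_unique)
qed

text \<open>The integral over \<open>[0, t]\<close> of the source computed in \<open>low_frequency_source\<close>.\<close>

definition quadratic_coeff :: "nat \<Rightarrow> real \<Rightarrow> real" where
  "quadratic_coeff N t = (let M = real N * (real N + 1) in
     pi / 2 * (real N)\<^sup>2 * ((3 - exp (- (2 * M * t)) * (2 * sin (3 * M * t) + 3 * cos (3 * M * t))) / (13 * M)))"

lemma quadratic_coeff_0: "quadratic_coeff N 0 = 0"
  by (simp add: quadratic_coeff_def)

lemma quadratic_coeff_derivative:
  assumes "1 \<le> N"
  shows "(quadratic_coeff N has_real_derivative
     pi / 2 * (real N)\<^sup>2 * (exp (- (2 * (real N * (real N + 1)) * t)) * sin (3 * (real N * (real N + 1)) * t))) (at t within S)"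
proof -
  define M where "M = real N * (real N + 1)"
  have "M \<noteq> 0" using assms by (simp add: M_def)
  then show ?thesis
    unfolding quadratic_coeff_def Let_def M_def[symmetric]
    by (auto intro!: derivative_eq_intros simp: divide_simps) (simp add: algebra_simps)
qed

text \<open>As \<open>N\<close> grows, \<open>N^2 / M\<close> tends to \<open>1\<close> and the exponential to \<open>0\<close>, so that the coefficient tends to
\<open>3 \<pi> / 26\<close>.\<close>

lemma quadratic_coeff_lower_bound:
  assumes "1 \<le> N" "0 < t" "2 \<le> real N * t"
  shows "pi / 26 \<le> quadratic_coeff N t"
proof -
  define M where "M = real N * (real N + 1)"
  have M: "0 < M" using assms by (simp add: M_def)
  have "2 \<le> M * t"
    using assms mult_mono[of 1 "real N + 1" 2 "real N * t"] by (simp add: M_def mult_ac)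
  then have "exp (- (2 * M * t)) \<le> exp (- (4::real))" by simp
  also have "\<dots> \<le> 1 / 5"
    using exp_ge_add_one_self[of 4] by (simp add: exp_minus field_simps)
  finally have e: "exp (- (2 * M * t)) \<le> 1 / 5" .
  have sc: "2 * sin (3 * M * t) + 3 * cos (3 * M * t) \<le> 5"
    using sin_le_one[of "3 * M * t"] cos_le_one[of "3 * M * t"] by linarith
  have "exp (- (2 * M * t)) * (2 * sin (3 * M * t) + 3 * cos (3 * M * t)) \<le> exp (- (2 * M * t)) * 5"
    using sc by (intro mult_left_mono) auto
  also have "\<dots> \<le> 1" using e by simp
  finally have "2 / (13 * M) \<le> (3 - exp (- (2 * M * t)) * (2 * sin (3 * M * t) + 3 * cos (3 * M * t))) / (13 * M)"
    using M by (intro divide_right_mono) auto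
  then have "pi / 2 * (real N)\<^sup>2 * (2 / (13 * M)) \<le> quadratic_coeff N t"
    unfolding quadratic_coeff_def Let_def M_def[symmetric] by (intro mult_left_mono) auto
  moreover have "pi / 26 \<le> pi / 2 * (real N)\<^sup>2 * (2 / (13 * M))"
  proof -
    have "pi / 13 * (1 / 2) \<le> pi / 13 * (real N / (real N + 1))"
      using assms by (intro mult_left_mono) (auto simp: field_simps)
    moreover have "pi / 2 * (real N)\<^sup>2 * (2 / (13 * M)) = pi / 13 * (real N / (real N + 1))"
      using assms by (simp add: M_def power2_eq_square)
    ultimately show ?thesis by simp
  qed
  ultimately show ?thesis by linarith
qed

section \<open>Second-order expansion of classical solutions\<close>

text \<open>With \<open>w = v - l\<close> one has \<open>v^2 - l^2 = w^2 + 2 l w\<close>. The hypotheses say that \<open>w\<close> has size \<open>\<epsilon>^2\<close> in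
\<open>L^2\<close> and \<open>l\<close> has size \<open>\<epsilon>\<close>, so the difference of the squares has size \<open>\<epsilon>^3\<close>.\<close>

lemma source_difference_bound:
  assumes V: "kdvb_jet V (\<lambda>t x. V 0 t x * V 1 t x)" and l: "kdvb_jet l (\<lambda>t x. 0)"
    and bd: "\<And>x. \<bar>l 0 \<tau> x\<bar> \<le> \<epsilon> * C"
    and E: "integral {0..2*pi} (\<lambda>x. (V 0 \<tau> x - l 0 \<tau> x)\<^sup>2) \<le> K * \<epsilon> ^ 4"
    and \<epsilon>: "0 < \<epsilon>" "\<epsilon> \<le> 1" and C: "0 \<le> C" and K: "0 \<le> K" and \<tau>: "0 \<le> \<tau>"
  shows "\<bar>integral {0..2*pi} (\<lambda>x. 1/2 * (V 0 \<tau> x)\<^sup>2 * backward_wave 1 \<tau> x)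
        - integral {0..2*pi} (\<lambda>x. 1/2 * (l 0 \<tau> x)\<^sup>2 * backward_wave 1 \<tau> x)\<bar>
     \<le> exp \<tau> / 2 * ((1 + C) * K + 2 * pi * C) * \<epsilon> ^ 3"
proof -
  have slice: "continuous_on {0..2*pi} (g \<tau>)"
    if "continuous_on ({0..} \<times> UNIV) (\<lambda>p. g (fst p) (snd p))" for g :: "real \<Rightarrow> real \<Rightarrow> real"
    using that \<tau> by (intro continuous_on_compose2[OF that(1), of _ "\<lambda>x. (\<tau>, x)", simplified])
       (auto intro!: continuous_intros)
  note [continuous_intros] = slice[OF kdvb_jetD(1)[OF V]] slice[OF kdvb_jetD(1)[OF l]] slice[OF continuous_backward_wave]
  let ?w = "\<lambda>x. V 0 \<tau> x - l 0 \<tau> x"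
  let ?d = "\<lambda>x. 1/2 * (V 0 \<tau> x)\<^sup>2 * backward_wave 1 \<tau> x - 1/2 * (l 0 \<tau> x)\<^sup>2 * backward_wave 1 \<tau> x"
  have int: "integral {0..2*pi} ?d = integral {0..2*pi} (\<lambda>x. 1/2 * (V 0 \<tau> x)\<^sup>2 * backward_wave 1 \<tau> x)
        - integral {0..2*pi} (\<lambda>x. 1/2 * (l 0 \<tau> x)\<^sup>2 * backward_wave 1 \<tau> x)"
    by (rule integral_diff) (intro integrable_continuous_real continuous_intros)+
  have "norm (integral {0..2*pi} ?d) \<le> integral {0..2*pi} (\<lambda>x. exp \<tau> / 2 * ((1 + C / \<epsilon>) * (?w x)\<^sup>2 + C * \<epsilon> ^ 3))"
  proof (rule integral_norm_bound_integral)
    fix x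
    \<comment> \<open>Both terms on the right are of order \<open>\<epsilon>^3\<close> when \<open>w\<close> is of order \<open>\<epsilon>^2\<close>.\<close>
    have "2 * (\<bar>?w x\<bar> * \<epsilon>) \<le> (?w x)\<^sup>2 / \<epsilon> + \<epsilon> ^ 3"
    proof -
      have "0 \<le> (\<bar>?w x\<bar> - \<epsilon> ^ 2)\<^sup>2 / \<epsilon>" using \<epsilon> by simp
      also have "\<dots> = (?w x)\<^sup>2 / \<epsilon> + \<epsilon> ^ 3 - 2 * (\<bar>?w x\<bar> * \<epsilon>)"
        using \<epsilon> by (simp add: power2_diff field_simps eval_nat_numeral)
      finally show ?thesis by simp
    qed
    then have "C * (2 * (\<bar>?w x\<bar> * \<epsilon>)) \<le> C * ((?w x)\<^sup>2 / \<epsilon> + \<epsilon> ^ 3)"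
      using C by (rule mult_left_mono)
    moreover have "\<bar>?w x\<bar> * \<bar>l 0 \<tau> x\<bar> \<le> \<bar>?w x\<bar> * (\<epsilon> * C)"
      using bd by (intro mult_left_mono) auto
    moreover have "\<bar>(V 0 \<tau> x)\<^sup>2 - (l 0 \<tau> x)\<^sup>2\<bar> \<le> (?w x)\<^sup>2 + 2 * (\<bar>?w x\<bar> * \<bar>l 0 \<tau> x\<bar>)"
    proof -
      have "(V 0 \<tau> x)\<^sup>2 - (l 0 \<tau> x)\<^sup>2 = (?w x)\<^sup>2 + 2 * (?w x * l 0 \<tau> x)"
        by (simp add: power2_eq_square algebra_simps)
      then show ?thesis
        using abs_triangle_ineq[of "(?w x)\<^sup>2" "2 * (?w x * l 0 \<tau> x)"] by (simp add: abs_mult)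
    qed
    ultimately have "\<bar>(V 0 \<tau> x)\<^sup>2 - (l 0 \<tau> x)\<^sup>2\<bar> \<le> (1 + C / \<epsilon>) * (?w x)\<^sup>2 + C * \<epsilon> ^ 3"
      by (simp add: algebra_simps)
    moreover have "\<bar>backward_wave 1 \<tau> x\<bar> \<le> exp \<tau>"
      by (simp add: backward_wave_def abs_mult)
    ultimately have "\<bar>backward_wave 1 \<tau> x\<bar> / 2 * \<bar>(V 0 \<tau> x)\<^sup>2 - (l 0 \<tau> x)\<^sup>2\<bar> \<le> exp \<tau> / 2 * ((1 + C / \<epsilon>) * (?w x)\<^sup>2 + C * \<epsilon> ^ 3)"
      by (intro mult_mono) auto
    moreover have "?d x = backward_wave 1 \<tau> x / 2 * ((V 0 \<tau> x)\<^sup>2 - (l 0 \<tau> x)\<^sup>2)"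
      by (simp add: algebra_simps diff_divide_distrib)
    ultimately show "norm (?d x) \<le> exp \<tau> / 2 * ((1 + C / \<epsilon>) * (?w x)\<^sup>2 + C * \<epsilon> ^ 3)"
      by (simp only: abs_mult real_norm_def)
  qed (intro integrable_continuous_real continuous_intros)+
  also have "\<dots> = exp \<tau> / 2 * ((1 + C / \<epsilon>) * integral {0..2*pi} (\<lambda>x. (?w x)\<^sup>2) + 2 * pi * C * \<epsilon> ^ 3)"
  proof -
    have "integral {0..2*pi} (\<lambda>x. (1 + C / \<epsilon>) * (?w x)\<^sup>2 + C * \<epsilon> ^ 3)
        = integral {0..2*pi} (\<lambda>x. (1 + C / \<epsilon>) * (?w x)\<^sup>2) + integral {0..2*pi} (\<lambda>x. C * \<epsilon> ^ 3)"
      by (rule integral_add) (intro integrable_continuous_real continuous_intros)+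
    then show ?thesis by simp
  qed
  also have "\<dots> \<le> exp \<tau> / 2 * ((1 + C / \<epsilon>) * (K * \<epsilon> ^ 4) + 2 * pi * C * \<epsilon> ^ 3)"
    using E C \<epsilon> by (intro mult_left_mono add_right_mono) auto
  also have "(1 + C / \<epsilon>) * (K * \<epsilon> ^ 4) = K * (\<epsilon> + C) * \<epsilon> ^ 3"
    using \<epsilon> by (simp add: field_simps eval_nat_numeral)
  also have "exp \<tau> / 2 * (K * (\<epsilon> + C) * \<epsilon> ^ 3 + 2 * pi * C * \<epsilon> ^ 3) \<le> exp \<tau> / 2 * (K * (1 + C) * \<epsilon> ^ 3 + 2 * pi * C * \<epsilon> ^ 3)"
    using C \<epsilon> K by (intro mult_left_mono add_right_mono mult_right_mono) auto
  finally show ?thesis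
    unfolding int by (simp add: algebra_simps)
qed

text \<open>The difference between the pairing and \<open>quadratic_coeff N \<cdot> \<epsilon>^2\<close> vanishes at time \<open>0\<close>, and its time
derivative is \<open>O(\<epsilon>^3)\<close>. The constant \<open>K\<close> depends on \<open>N\<close> and \<open>t\<close>, but not on the solution.\<close>

lemma second_order_expansion:
  assumes N: "2 \<le> N" and t: "0 \<le> t"
  shows "\<exists>K. \<forall>\<epsilon> V. 0 < \<epsilon> \<longrightarrow> \<epsilon> \<le> 1 \<longrightarrow> kdvb_jet V (\<lambda>t x. V 0 t x * V 1 t x) \<longrightarrow>
      (\<forall>x. V 0 0 x = \<epsilon> * pair_wave N 0 0 x) \<longrightarrow>
      \<bar>integral {0..2*pi} (\<lambda>x. V 0 t x * backward_wave 0 t x) - quadratic_coeff N t * \<epsilon>\<^sup>2\<bar> \<le> K * \<epsilon> ^ 3"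
proof -
  define C where "C = 2 * real N * (real N + 1)"
  define K where "K = exp ((1 + C) * t) * (2 * pi * C ^ 4) * t"
  define D where "D = exp t / 2 * ((1 + C) * K + 2 * pi * C)"
  have C: "0 \<le> C" by (simp add: C_def)
  then have K: "0 \<le> K" using t by (simp add: K_def)
  define h where "h = (\<lambda>\<tau>. pi / 2 * (real N)\<^sup>2 * (exp (- (2 * (real N * (real N + 1)) * \<tau>)) * sin (3 * (real N * (real N + 1)) * \<tau>)))"
  have "\<bar>integral {0..2*pi} (\<lambda>x. V 0 t x * backward_wave 0 t x) - quadratic_coeff N t * \<epsilon>\<^sup>2\<bar> \<le> (D * t) * \<epsilon> ^ 3"
    if \<epsilon>: "0 < \<epsilon>" "\<epsilon> \<le> 1" and V: "kdvb_jet V (\<lambda>t x. V 0 t x * V 1 t x)"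
      and init: "\<And>x. V 0 0 x = \<epsilon> * pair_wave N 0 0 x" for \<epsilon> V
  proof -
    define l where "l = (\<lambda>j t x. \<epsilon> * pair_wave N j t x)"
    have l: "kdvb_jet l (\<lambda>t x. 0)"
      using kdvb_jet_lincomb[OF pair_wave_jet pair_wave_jet, of \<epsilon> N 0 N] by (simp add: l_def)
    have lb: "\<bar>l j \<tau> x\<bar> \<le> \<epsilon> * C" if "0 \<le> \<tau>" "j \<le> 1" for j \<tau> x
      using abs_pair_wave_le[OF that] \<epsilon> by (simp add: l_def C_def abs_mult mult.assoc)
    let ?P = "\<lambda>\<tau>. integral {0..2*pi} (\<lambda>x. V 0 \<tau> x * backward_wave 0 \<tau> x)"
    let ?R = "\<lambda>\<tau>. integral {0..2*pi} (\<lambda>x. 1/2 * (V 0 \<tau> x)\<^sup>2 * backward_wave 1 \<tau> x)"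
    have dP: "(?P has_real_derivative ?R \<tau>) (at \<tau> within {0..})" if "0 \<le> \<tau>" for \<tau>
      by (rule pairing_derivative[OF V that])
    have dc: "(quadratic_coeff N has_real_derivative h \<tau>) (at \<tau> within {0..})" for \<tau>
      unfolding h_def using N by (intro quadratic_coeff_derivative) auto
    have R: "\<bar>?R \<tau> - h \<tau> * \<epsilon>\<^sup>2\<bar> \<le> D * \<epsilon> ^ 3" if \<tau>: "0 \<le> \<tau>" "\<tau> \<le> t" for \<tau>
    proof -
      have "integral {0..2*pi} (\<lambda>x. (V 0 \<tau> x - l 0 \<tau> x)\<^sup>2) \<le> exp ((1 + \<epsilon> * C) * \<tau>) * (2 * pi * (\<epsilon> * C) ^ 4) * \<tau>"
        by (rule perturbation_energy_bound[OF V l lb]) (use \<tau> init in \<open>auto simp: l_def\<close>)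
      also have "\<dots> \<le> exp ((1 + C) * t) * (2 * pi * (\<epsilon> * C) ^ 4) * t"
        using \<tau> C \<epsilon> t by (intro mult_mono) (auto intro!: mult_mono mult_left_le_one_le)
      also have "\<dots> = K * \<epsilon> ^ 4"
        by (simp add: K_def power_mult_distrib mult_ac)
      finally have E: "integral {0..2*pi} (\<lambda>x. (V 0 \<tau> x - l 0 \<tau> x)\<^sup>2) \<le> K * \<epsilon> ^ 4" .
      have "integral {0..2*pi} (\<lambda>x. 1/2 * (l 0 \<tau> x)\<^sup>2 * backward_wave 1 \<tau> x)
          = integral {0..2*pi} (\<lambda>x. \<epsilon>\<^sup>2 * (1/2 * (pair_wave N 0 \<tau> x)\<^sup>2 * backward_wave 1 \<tau> x))"
        by (simp add: l_def power_mult_distrib mult_ac)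
      also have "\<dots> = \<epsilon>\<^sup>2 * h \<tau>"
        using low_frequency_source[of N \<tau>] N by (simp only: integral_mult_right h_def)
      finally have "\<bar>?R \<tau> - h \<tau> * \<epsilon>\<^sup>2\<bar> \<le> exp \<tau> / 2 * ((1 + C) * K + 2 * pi * C) * \<epsilon> ^ 3"
        using source_difference_bound[OF V l lb E \<epsilon> C K \<tau>(1)] \<tau> by (simp add: mult.commute)
      also have "\<dots> \<le> D * \<epsilon> ^ 3"
        unfolding D_def using \<tau> C K \<epsilon> by (intro mult_right_mono) auto
      finally show ?thesis .
    qed
    have P0: "?P 0 = 0"
      using pair_wave_initial_pairing[OF N] by (simp add: init mult.assoc)
    have d: "((\<lambda>\<tau>. ?P \<tau> - quadratic_coeff N \<tau> * \<epsilon>\<^sup>2) has_real_derivative ?R \<tau> - h \<tau> * \<epsilon>\<^sup>2) (at \<tau> within {0..})"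
      if "0 \<le> \<tau>" for \<tau>
      by (intro DERIV_diff dP[OF that] DERIV_cmult_right dc)
    have "(?P t - quadratic_coeff N t * \<epsilon>\<^sup>2) - (?P 0 - quadratic_coeff N 0 * \<epsilon>\<^sup>2) \<le> (D * \<epsilon> ^ 3) * t"
      by (rule deriv_bound_imp_increment_bound[OF d _ t]) (use R in \<open>simp_all add: abs_le_iff\<close>)
    moreover have "- (?P t - quadratic_coeff N t * \<epsilon>\<^sup>2) - - (?P 0 - quadratic_coeff N 0 * \<epsilon>\<^sup>2) \<le> (D * \<epsilon> ^ 3) * t"
      by (rule deriv_bound_imp_increment_bound[OF DERIV_minus[OF d] _ t]) (use R in \<open>simp_all add: abs_le_iff\<close>)
    ultimately show ?thesis
      unfolding P0 quadratic_coeff_0 by (simp add: abs_le_iff algebra_simps)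
  qed
  then show ?thesis
    by (intro exI[of _ "D * t"] allI impI) blast
qed

section \<open>Distributions and Sobolev norms\<close>

lemma dist_apply_lincomb:
  "dist_apply (a *\<^sub>R u + b *\<^sub>R v) f = a * dist_apply u f + b * dist_apply v f"
  by (simp add: plus_distribution.rep_eq scaleR_distribution.rep_eq)

lemma dist_apply_diff: "dist_apply (u - v) f = dist_apply u f - dist_apply v f"
  by (simp add: minus_distribution.rep_eq)

lemma dist_apply_sum: "dist_apply (\<Sum>i\<in>I. u i) f = (\<Sum>i\<in>I. dist_apply (u i) f)"
  by (induction I rule: infinite_finite_induct)
     (simp_all add: zero_distribution.rep_eq plus_distribution.rep_eq)

lemma linear_dist_apply: "linear (dist_apply u)"
  using dist_apply[of u] by simp

lemma fourier_lincomb: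
  "fourier (a *\<^sub>R u + b *\<^sub>R v) k = of_real a * fourier u k + of_real b * fourier v k"
  unfolding fourier_def dist_apply_lincomb by (simp add: complex_eq_iff add_divide_distrib diff_divide_distrib algebra_simps)

lemma sobolev_lincomb:
  assumes "u \<in> sobolev s" "v \<in> sobolev s"
  shows "a *\<^sub>R u + b *\<^sub>R v \<in> sobolev s"
proof -
  let ?w = "\<lambda>k::int. (1 + (real_of_int k)\<^sup>2) powr s"
  have "(\<lambda>k::int. 2 * a\<^sup>2 * (?w k * (cmod (fourier u k))\<^sup>2) + 2 * b\<^sup>2 * (?w k * (cmod (fourier v k))\<^sup>2)) summable_on UNIV"
    using assms unfolding sobolev_def by (intro summable_on_add summable_on_cmult_right) auto
  then show ?thesis
    unfolding sobolev_def mem_Collect_eq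
  proof (rule summable_on_comparison_test)
    fix k :: int
    have "cmod (fourier (a *\<^sub>R u + b *\<^sub>R v) k) \<le> \<bar>a\<bar> * cmod (fourier u k) + \<bar>b\<bar> * cmod (fourier v k)"
      unfolding fourier_lincomb by (rule order_trans[OF norm_triangle_ineq]) (simp add: norm_mult)
    then have "(cmod (fourier (a *\<^sub>R u + b *\<^sub>R v) k))\<^sup>2 \<le> (\<bar>a\<bar> * cmod (fourier u k) + \<bar>b\<bar> * cmod (fourier v k))\<^sup>2"
      by (intro power_mono) auto
    also have "\<dots> \<le> 2 * a\<^sup>2 * (cmod (fourier u k))\<^sup>2 + 2 * b\<^sup>2 * (cmod (fourier v k))\<^sup>2"
      using zero_le_power2[of "\<bar>a\<bar> * cmod (fourier u k) - \<bar>b\<bar> * cmod (fourier v k)"]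
      by (simp add: power2_sum power2_diff power_mult_distrib)
    finally have "?w k * (cmod (fourier (a *\<^sub>R u + b *\<^sub>R v) k))\<^sup>2
        \<le> ?w k * (2 * a\<^sup>2 * (cmod (fourier u k))\<^sup>2 + 2 * b\<^sup>2 * (cmod (fourier v k))\<^sup>2)"
      by (intro mult_left_mono) auto
    then show "?w k * (cmod (fourier (a *\<^sub>R u + b *\<^sub>R v) k))\<^sup>2
        \<le> 2 * a\<^sup>2 * (?w k * (cmod (fourier u k))\<^sup>2) + 2 * b\<^sup>2 * (?w k * (cmod (fourier v k))\<^sup>2)"
      by (simp add: algebra_simps)
  qed auto
qed

lemma sobolev_scaleR: "u \<in> sobolev s \<Longrightarrow> a *\<^sub>R u \<in> sobolev s"
  using sobolev_lincomb[of u s u a 0] by simp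

lemma sobolev_diff: "u \<in> sobolev s \<Longrightarrow> v \<in> sobolev s \<Longrightarrow> u - v \<in> sobolev s"
  using sobolev_lincomb[of u s v 1 "-1"] by simp

lemma sobolev_sum: "(\<And>i. i \<in> I \<Longrightarrow> u i \<in> sobolev s) \<Longrightarrow> (\<Sum>i\<in>I. u i) \<in> sobolev s"
proof (induction I rule: infinite_finite_induct)
  case (insert i I)
  then show ?case using sobolev_lincomb[of "u i" s "\<Sum>i\<in>I. u i" 1 1] by simp
qed (simp_all add: zero_in_sobolev)

lemma sobolev_norm_scaleR: "sobolev_norm s (a *\<^sub>R u) = \<bar>a\<bar> * sobolev_norm s u"
proof -
  have "fourier (a *\<^sub>R u) k = of_real a * fourier u k" for k
    using fourier_lincomb[of a u 0 u] by simp
  then have "(\<lambda>k::int. (1 + (real_of_int k)\<^sup>2) powr s * (cmod (fourier (a *\<^sub>R u) k))\<^sup>2)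
      = (\<lambda>k. a\<^sup>2 * ((1 + (real_of_int k)\<^sup>2) powr s * (cmod (fourier u k))\<^sup>2))"
    by (simp add: norm_mult power_mult_distrib mult_ac)
  then show ?thesis
    unfolding sobolev_norm_def by (simp add: infsum_cmult_right' real_sqrt_mult)
qed

lemma sobolev_norm_nonneg: "0 \<le> sobolev_norm s u"
  unfolding sobolev_norm_def by (intro real_sqrt_ge_zero infsum_nonneg) simp

lemma fourier_le_sobolev_norm:
  assumes "u \<in> sobolev s"
  shows "sqrt ((1 + (real_of_int k)\<^sup>2) powr s) * cmod (fourier u k) \<le> sobolev_norm s u"
proof -
  let ?f = "\<lambda>k::int. (1 + (real_of_int k)\<^sup>2) powr s * (cmod (fourier u k))\<^sup>2"
  have "sum ?f {k} \<le> infsum ?f UNIV"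
    using assms unfolding sobolev_def by (intro finite_sum_le_infsum) auto
  then have "sqrt (?f k) \<le> sobolev_norm s u"
    unfolding sobolev_norm_def by (intro real_sqrt_le_mono) simp
  then show ?thesis by (simp add: real_sqrt_mult)
qed

text \<open>\<open>e^t cos(x + t)\<close>, the backward wave at time \<open>t\<close>, as a test function.\<close>

definition observable :: "real \<Rightarrow> test" where
  "observable t = exp t *\<^sub>R (cos t *\<^sub>R cos_test 1 - sin t *\<^sub>R sin_test 1)"

lemma test_fun_observable: "test_fun (observable t) x = backward_wave 0 t x"
  by (simp add: observable_def backward_wave_def scaleR_test.rep_eq minus_test.rep_eq
      cos_test.rep_eq sin_test.rep_eq cos_add mult_ac)

text \<open>The observable involves the Fourier coefficient at frequency \<open>1\<close> only.\<close>

lemma observable_bounded: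
  "\<exists>C\<ge>0. \<forall>u\<in>sobolev (-1). \<bar>dist_apply u (observable t)\<bar> \<le> C * sobolev_norm (-1) u"
proof (intro exI[of _ "exp t * (4 * pi * sqrt 2)"] conjI ballI)
  fix u assume u: "u \<in> sobolev (-1)"
  let ?c = "dist_apply u (cos_test 1)" and ?s = "dist_apply u (sin_test 1)"
  have eq: "dist_apply u (observable t) = exp t * (cos t * ?c - sin t * ?s)"
    by (simp add: observable_def linear_scale[OF linear_dist_apply] linear_diff[OF linear_dist_apply])
  have F: "Complex ?c (- ?s) = of_real (2 * pi) * fourier u 1"
    by (simp add: fourier_def)
  have n: "cmod (Complex ?c (- ?s)) = 2 * pi * cmod (fourier u 1)"
    unfolding F norm_mult by simp
  have "\<bar>?c\<bar> \<le> 2 * pi * cmod (fourier u 1)" "\<bar>?s\<bar> \<le> 2 * pi * cmod (fourier u 1)"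
    using abs_Re_le_cmod[of "Complex ?c (- ?s)"] abs_Im_le_cmod[of "Complex ?c (- ?s)"] n by simp_all
  moreover have "\<bar>cos t * ?c - sin t * ?s\<bar> \<le> 1 * \<bar>?c\<bar> + 1 * \<bar>?s\<bar>"
    by (rule order_trans[OF abs_triangle_ineq4])
       (simp only: abs_mult, intro add_mono mult_right_mono, auto)
  ultimately have "\<bar>cos t * ?c - sin t * ?s\<bar> \<le> 4 * pi * cmod (fourier u 1)" by simp
  moreover have "cmod (fourier u 1) \<le> sqrt 2 * sobolev_norm (-1) u"
    using fourier_le_sobolev_norm[OF u, of 1] by (simp add: powr_minus real_sqrt_inverse real_sqrt_divide field_simps)
  then have "4 * pi * cmod (fourier u 1) \<le> 4 * pi * (sqrt 2 * sobolev_norm (-1) u)"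
    by (intro mult_left_mono) auto
  ultimately have "\<bar>cos t * ?c - sin t * ?s\<bar> \<le> 4 * pi * (sqrt 2 * sobolev_norm (-1) u)"
    by (rule order_trans)
  then show "\<bar>dist_apply u (observable t)\<bar> \<le> exp t * (4 * pi * sqrt 2) * sobolev_norm (-1) u"
    unfolding eq abs_mult by (simp add: mult.assoc)
qed simp

lemma continuous_on_test_fun: "continuous_on S (test_fun f)"
proof -
  have "(test_fun f) differentiable (at x)" for x
    using test_fun[of f] unfolding smooth_real_def by (auto dest: spec[of _ 0])
  then show ?thesis
    by (intro continuous_at_imp_continuous_on ballI differentiable_imp_continuous_within)
qed

lemma representsD:
  assumes "represents g u" "continuous_on {0..2*pi} g"
  shows "dist_apply u f = integral {0..2*pi} (\<lambda>x. g x * test_fun f x)"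
proof -
  have "set_integrable lborel {0..2*pi} (\<lambda>x. g x * test_fun f x)"
    using assms(2) by (intro borel_integrable_atLeastAtMost' continuous_intros continuous_on_test_fun)
  then show ?thesis
    using assms(1) set_borel_integral_eq_integral(2) unfolding represents_def by metis
qed

lemma continuous_represents_distribution:
  assumes g: "continuous_on {0..2*pi} g"
  shows "\<exists>u. represents g u"
proof -
  define L where "L = (\<lambda>f. integral {0..2*pi} (\<lambda>x. g x * test_fun f x))"
  have int: "(\<lambda>x. g x * test_fun f x) integrable_on {0..2*pi}" for f
    using g by (intro integrable_continuous_real continuous_intros continuous_on_test_fun)
  have "linear L"
  proof
    show "L (f + h) = L f + L h" for f h
      unfolding L_def integral_add[OF int int, symmetric] by (simp add: plus_test.rep_eq distrib_left)
    show "L (c *\<^sub>R f) = c *\<^sub>R L f" for c f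
      unfolding L_def real_scaleR_def integral_mult_right[symmetric] by (simp add: scaleR_test.rep_eq mult_ac)
  qed
  moreover have "bounded (g ` {0..2*pi})"
    by (rule compact_imp_bounded[OF compact_continuous_image[OF g compact_Icc]])
  then obtain M where "\<forall>y\<in>g ` {0..2*pi}. norm y \<le> M"
    unfolding bounded_iff by blast
  then have M: "\<bar>g x\<bar> \<le> M" if "x \<in> {0..2*pi}" for x
    using that by auto
  then have "0 \<le> M" using M[of 0] by (smt (verit) atLeastAtMost_iff pi_gt_zero)
  have "dist_continuous L"
    unfolding dist_continuous_def
  proof (intro exI allI impI)
    fix f B assume B: "\<forall>j\<le>0. \<forall>x. \<bar>(deriv ^^ j) (test_fun f) x\<bar> \<le> B"
    have "norm (L f) \<le> integral {0..2*pi} (\<lambda>x. M * B)"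
      unfolding L_def
    proof (rule integral_norm_bound_integral[OF int])
      fix x assume "x \<in> {0..2*pi}"
      then show "norm (g x * test_fun f x) \<le> M * B"
        using M B \<open>0 \<le> M\<close> by (simp add: abs_mult mult_mono)
    qed auto
    then show "\<bar>L f\<bar> \<le> 2 * pi * M * B" by (simp add: mult_ac)
  qed
  ultimately have "dist_apply (Abs_distribution L) = L"
    by (simp add: Abs_distribution_inverse)
  then have "represents g (Abs_distribution L)"
    using g unfolding represents_def L_def
    by (auto intro!: borel_integrable_atLeastAtMost' set_borel_integral_eq_integral(2)[symmetric] continuous_intros continuous_on_test_fun)
  then show ?thesis ..
qed

lemma represents_scaleR: "represents g u \<Longrightarrow> represents (\<lambda>x. c * g x) (c *\<^sub>R u)"
  unfolding represents_def scaleR_distribution.rep_eq set_lebesgue_integral_def set_integrable_def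
  by (simp add: mult.assoc mult.left_commute[of _ c])

section \<open>The initial data in Sobolev spaces\<close>

lemma integral_cos_int:
  "integral {0..2*pi} (\<lambda>x. cos (of_int k * x)) = (if k = 0 then 2 * pi else 0)"
proof (cases "k = 0")
  case False
  then have "((\<lambda>x. sin (of_int k * x + pi / 2)) has_integral 0) {0..2*pi}"
    by (intro has_integral_sin_period) auto
  then show ?thesis using False by (simp add: sin_add integral_unique)
qed simp

lemma integral_sin_int: "integral {0..2*pi} (\<lambda>x. sin (of_int k * x)) = 0"
proof (cases "k = 0")
  case False
  then have "((\<lambda>x. sin (of_int k * x + 0)) has_integral 0) {0..2*pi}"
    by (intro has_integral_sin_period) auto
  then show ?thesis by (simp add: integral_unique)
qed simp

lemma integral_cos_cos:
  "integral {0..2*pi} (\<lambda>x. cos (of_int m * x) * cos (of_int k * x))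
     = (if k = m then pi else 0) + (if k = - m then pi else 0)"
proof -
  have "cos (of_int m * x) * cos (of_int k * x) = 1/2 * cos (of_int (m - k) * x) + 1/2 * cos (of_int (m + k) * x)" for x :: real
    by (simp add: cos_times_cos left_diff_distrib distrib_right)
  then have "integral {0..2*pi} (\<lambda>x. cos (of_int m * x) * cos (of_int k * x))
      = 1/2 * integral {0..2*pi} (\<lambda>x. cos (of_int (m - k) * x)) + 1/2 * integral {0..2*pi} (\<lambda>x. cos (of_int (m + k) * x))"
    by (simp only: integral_mult_right[symmetric])
       (intro integral_add integrable_continuous_real continuous_intros)
  then show ?thesis unfolding integral_cos_int by auto
qed

lemma integral_cos_sin:
  "integral {0..2*pi} (\<lambda>x. cos (of_int m * x) * sin (of_int k * x)) = 0"
proof -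
  have "cos (of_int m * x) * sin (of_int k * x) = 1/2 * sin (of_int (m + k) * x) - 1/2 * sin (of_int (m - k) * x)" for x :: real
    by (simp add: cos_times_sin left_diff_distrib distrib_right diff_divide_distrib)
  then have "integral {0..2*pi} (\<lambda>x. cos (of_int m * x) * sin (of_int k * x))
      = 1/2 * integral {0..2*pi} (\<lambda>x. sin (of_int (m + k) * x)) - 1/2 * integral {0..2*pi} (\<lambda>x. sin (of_int (m - k) * x))"
    by (simp only: integral_mult_right[symmetric])
       (intro integral_diff integrable_continuous_real continuous_intros)
  then show ?thesis unfolding integral_sin_int by simp
qed

lemma pair_wave_initial:
  "pair_wave N 0 0 x = real N * cos (of_int (int N) * x) + real N * cos (of_int (int N + 1) * x)"
  by (simp add: pair_wave_def wave_def add.commute)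

lemma continuous_pair_wave_initial: "continuous_on S (pair_wave N 0 0)"
  unfolding pair_wave_initial[abs_def] by (intro continuous_intros)

lemma fourier_pair_wave:
  assumes d: "represents (pair_wave N 0 0) d" and N: "1 \<le> N"
  shows "fourier d k = (if \<bar>k\<bar> = int N \<or> \<bar>k\<bar> = int N + 1 then of_real (real N / 2) else 0)"
proof -
  have split: "integral {0..2*pi} (\<lambda>x. pair_wave N 0 0 x * g x)
     = real N * integral {0..2*pi} (\<lambda>x. cos (of_int (int N) * x) * g x)
       + real N * integral {0..2*pi} (\<lambda>x. cos (of_int (int N + 1) * x) * g x)"
    if "continuous_on {0..2*pi} g" for g :: "real \<Rightarrow> real"
    unfolding pair_wave_initial distrib_right mult.assoc integral_mult_right[symmetric]
    by (intro integral_add integrable_continuous_real continuous_intros that)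
  have "dist_apply d (cos_test k) = integral {0..2*pi} (\<lambda>x. pair_wave N 0 0 x * cos (of_int k * x))"
    by (simp add: representsD[OF d continuous_pair_wave_initial] cos_test.rep_eq)
  also have "\<dots> = (if \<bar>k\<bar> = int N \<or> \<bar>k\<bar> = int N + 1 then real N * pi else 0)"
    using N by (subst split) (auto simp only: integral_cos_cos intro!: continuous_intros, auto)
  finally have c: "dist_apply d (cos_test k) = (if \<bar>k\<bar> = int N \<or> \<bar>k\<bar> = int N + 1 then real N * pi else 0)" .
  have "dist_apply d (sin_test k) = integral {0..2*pi} (\<lambda>x. pair_wave N 0 0 x * sin (of_int k * x))"
    by (simp add: representsD[OF d continuous_pair_wave_initial] sin_test.rep_eq)
  also have "\<dots> = 0"
    by (subst split) (auto simp only: integral_cos_sin intro!: continuous_intros)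
  finally show ?thesis
    unfolding fourier_def c by (simp add: complex_eq_iff)
qed

text \<open>The four nonzero Fourier coefficients equal \<open>N / 2\<close>, and each is weighted by at most \<open>N^(2 s)\<close>
because \<open>s \<le> 0\<close>.\<close>

lemma pair_wave_sobolev:
  assumes d: "represents (pair_wave N 0 0) d" and N: "1 \<le> N" and s: "s \<le> 0"
  shows "d \<in> sobolev s" "sobolev_norm s d \<le> real N powr (1 + s)"
proof -
  let ?f = "\<lambda>k::int. (1 + (real_of_int k)\<^sup>2) powr s * (cmod (fourier d k))\<^sup>2"
  let ?S = "{int N, - int N, int N + 1, - (int N + 1)}"
  have sum: "(?f has_sum sum ?f ?S) UNIV"
    by (rule has_sum_finite_neutralI) (auto simp: fourier_pair_wave[OF d N])
  then show "d \<in> sobolev s"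
    unfolding sobolev_def by (auto intro: has_sum_imp_summable)
  have "sum ?f ?S \<le> of_nat (card ?S) * (((real N)\<^sup>2) powr s * (real N / 2)\<^sup>2)"
  proof (rule sum_bounded_above)
    fix k assume k: "k \<in> ?S"
    then have "(int N)\<^sup>2 \<le> k\<^sup>2" by (intro abs_le_square_iff[THEN iffD1]) auto
    then have "(real N)\<^sup>2 \<le> (real_of_int k)\<^sup>2"
      by (metis of_int_le_iff of_int_of_nat_eq of_int_power)
    then have "(1 + (real_of_int k)\<^sup>2) powr s \<le> ((real N)\<^sup>2) powr s"
      using s N by (intro powr_mono2') auto
    moreover have "cmod (fourier d k) \<le> real N / 2"
      unfolding fourier_pair_wave[OF d N] by auto
    then have "(cmod (fourier d k))\<^sup>2 \<le> (real N / 2)\<^sup>2" by (intro power_mono) auto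
    ultimately show "?f k \<le> ((real N)\<^sup>2) powr s * (real N / 2)\<^sup>2"
      by (intro mult_mono) auto
  qed
  also have "\<dots> \<le> 4 * (((real N)\<^sup>2) powr s * (real N / 2)\<^sup>2)"
    by (intro mult_right_mono) (auto simp: card_insert_if)
  also have "\<dots> = (real N powr (1 + s))\<^sup>2"
    using N by (simp add: powr_add powr_mult power2_eq_square)
  finally have "infsum ?f UNIV \<le> (real N powr (1 + s))\<^sup>2"
    using infsumI[OF sum] by simp
  then show "sobolev_norm s d \<le> real N powr (1 + s)"
    unfolding sobolev_norm_def by (intro real_le_lsqrt) auto
qed

section \<open>Identifying the coefficients of a power series\<close>

lemma eq_0_if_abs_le_all_small:
  fixes x M \<rho> :: real
  assumes "0 < \<rho>" and "\<And>\<epsilon>. 0 < \<epsilon> \<Longrightarrow> \<epsilon> \<le> \<rho> \<Longrightarrow> \<bar>x\<bar> \<le> M * \<epsilon>"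
  shows "x = 0"
proof -
  have "((\<lambda>\<epsilon>. M * \<epsilon>) \<longlongrightarrow> M * 0) (at_right 0)"
    by (intro tendsto_intros)
  moreover have "\<forall>\<^sub>F \<epsilon> in at_right 0. \<bar>x\<bar> \<le> M * \<epsilon>"
    using eventually_at_right_less[of "0::real"] eventually_at_right_real[OF assms(1)]
    by eventually_elim (use assms(2) in auto)
  ultimately have "\<bar>x\<bar> \<le> M * 0"
    by (intro tendsto_lowerbound) auto
  then show ?thesis by simp
qed

lemma quadratic_eq_0_if_cubically_small:
  fixes x y z M \<rho> :: real
  assumes \<rho>: "0 < \<rho>" "\<rho> \<le> 1"
    and le: "\<And>\<epsilon>. 0 < \<epsilon> \<Longrightarrow> \<epsilon> \<le> \<rho> \<Longrightarrow> \<bar>x + y * \<epsilon> + z * \<epsilon>\<^sup>2\<bar> \<le> M * \<epsilon> ^ 3"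
  shows "x = 0" "y = 0" "z = 0"
proof -
  have M: "0 \<le> M"
    using order_trans[OF abs_ge_zero le[OF \<rho>(1) order_refl]] \<rho>(1) by (simp add: zero_le_mult_iff)
  have pow: "\<epsilon> ^ Suc n \<le> \<epsilon>" if "0 < \<epsilon>" "\<epsilon> \<le> \<rho>" for \<epsilon> n
    using that \<rho> mult_left_le[of "\<epsilon> ^ n" \<epsilon>] by (simp add: power_le_one)
  show x: "x = 0"
  proof (rule eq_0_if_abs_le_all_small[OF \<rho>(1)])
    fix \<epsilon> assume \<epsilon>: "0 < \<epsilon>" "\<epsilon> \<le> \<rho>"
    have "\<bar>x\<bar> \<le> \<bar>x + y * \<epsilon> + z * \<epsilon>\<^sup>2\<bar> + \<bar>y * \<epsilon>\<bar> + \<bar>z * \<epsilon>\<^sup>2\<bar>" by linarith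
    also have "\<dots> \<le> M * \<epsilon> + \<bar>y\<bar> * \<epsilon> + \<bar>z\<bar> * \<epsilon>"
      using order_trans[OF le[OF \<epsilon>] mult_left_mono[OF pow[OF \<epsilon>, of 2] M, simplified]] pow[OF \<epsilon>, of 1] \<epsilon>
      by (intro add_mono) (auto simp: abs_mult eval_nat_numeral intro!: mult_left_mono)
    finally show "\<bar>x\<bar> \<le> (M + \<bar>y\<bar> + \<bar>z\<bar>) * \<epsilon>" by (simp add: algebra_simps)
  qed
  show y: "y = 0"
  proof (rule eq_0_if_abs_le_all_small[OF \<rho>(1)])
    fix \<epsilon> assume \<epsilon>: "0 < \<epsilon>" "\<epsilon> \<le> \<rho>"
    have "\<bar>y\<bar> * \<epsilon> = \<bar>y * \<epsilon>\<bar>" using \<epsilon> by (simp add: abs_mult)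
    also have "\<dots> \<le> \<bar>y * \<epsilon> + z * \<epsilon>\<^sup>2\<bar> + \<bar>z * \<epsilon>\<^sup>2\<bar>" by linarith
    also have "\<dots> \<le> M * \<epsilon> ^ 3 + \<bar>z\<bar> * \<epsilon>\<^sup>2"
      using le[OF \<epsilon>] x by (simp add: abs_mult)
    also have "\<dots> = (M * \<epsilon>\<^sup>2 + \<bar>z\<bar> * \<epsilon>) * \<epsilon>" by (simp add: algebra_simps eval_nat_numeral)
    finally have "\<bar>y\<bar> \<le> M * \<epsilon>\<^sup>2 + \<bar>z\<bar> * \<epsilon>" using \<epsilon> by simp
    also have "\<dots> \<le> M * \<epsilon> + \<bar>z\<bar> * \<epsilon>"
      using mult_left_mono[OF pow[OF \<epsilon>, of 1] M] by (simp add: power2_eq_square)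
    finally show "\<bar>y\<bar> \<le> (M + \<bar>z\<bar>) * \<epsilon>" by (simp add: algebra_simps)
  qed
  show "z = 0"
  proof (rule eq_0_if_abs_le_all_small[OF \<rho>(1)])
    fix \<epsilon> assume \<epsilon>: "0 < \<epsilon>" "\<epsilon> \<le> \<rho>"
    have "\<bar>z\<bar> * \<epsilon>\<^sup>2 \<le> (M * \<epsilon>) * \<epsilon>\<^sup>2"
      using le[OF \<epsilon>] x y by (simp add: abs_mult eval_nat_numeral mult.assoc)
    then show "\<bar>z\<bar> \<le> M * \<epsilon>" using \<epsilon> by simp
  qed
qed

text \<open>The bound with \<open>K\<close> serves only to identify the coefficients of order at most \<open>2\<close>; the remainder is
then estimated by \<open>b\<close> alone. Hence a whole family of functions \<open>P\<close> with individual constants \<open>K\<close>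
but a common \<open>b\<close> has a common cubic remainder.\<close>

lemma power_series_cubic_remainder:
  fixes a b :: "nat \<Rightarrow> real" and P :: "real \<Rightarrow> real"
  assumes P: "\<And>\<epsilon>. 0 \<le> \<epsilon> \<Longrightarrow> \<epsilon> \<le> \<rho> \<Longrightarrow> (\<lambda>n. a n * \<epsilon> ^ n) sums P \<epsilon>"
    and ab: "\<And>n. \<bar>a n\<bar> \<le> b n" and b: "summable (\<lambda>n. b n * \<rho> ^ n)" and \<rho>: "0 < \<rho>" "\<rho> \<le> 1"
    and cubic: "\<And>\<epsilon>. 0 < \<epsilon> \<Longrightarrow> \<epsilon> \<le> 1 \<Longrightarrow> \<bar>P \<epsilon> - c * \<epsilon>\<^sup>2\<bar> \<le> K * \<epsilon> ^ 3"
  shows "P 0 = 0" and "0 < \<epsilon> \<Longrightarrow> \<epsilon> \<le> \<rho> \<Longrightarrow> \<bar>P \<epsilon> - c * \<epsilon>\<^sup>2\<bar> \<le> (\<Sum>n. b (n + 3) * \<rho> ^ n) * \<epsilon> ^ 3"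
proof -
  let ?B = "\<Sum>n. b (n + 3) * \<rho> ^ n"
  have "summable (\<lambda>n. b (n + 3) * \<rho> ^ (n + 3))"
    using b by (subst summable_iff_shift)
  then have "summable (\<lambda>n. b (n + 3) * \<rho> ^ (n + 3) / \<rho> ^ 3)"
    by (rule summable_divide)
  then have sB: "summable (\<lambda>n. b (n + 3) * \<rho> ^ n)"
    using \<rho> by (simp add: power_add)
  have tail: "\<bar>P \<epsilon> - (a 0 + a 1 * \<epsilon> + a 2 * \<epsilon>\<^sup>2)\<bar> \<le> ?B * \<epsilon> ^ 3" if \<epsilon>: "0 < \<epsilon>" "\<epsilon> \<le> \<rho>" for \<epsilon>
  proof -
    have "(\<lambda>n. a (n + 3) * \<epsilon> ^ (n + 3)) sums (P \<epsilon> - (\<Sum>n<3. a n * \<epsilon> ^ n))"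
      using P[of \<epsilon>] \<epsilon> by (subst sums_iff_shift') auto
    then have sums_a: "(\<lambda>n. a (n + 3) * \<epsilon> ^ n * \<epsilon> ^ 3) sums (P \<epsilon> - (a 0 + a 1 * \<epsilon> + a 2 * \<epsilon>\<^sup>2))"
      by (simp add: eval_nat_numeral power_add mult_ac)
    have sums_b: "(\<lambda>n. b (n + 3) * \<rho> ^ n * \<epsilon> ^ 3) sums (?B * \<epsilon> ^ 3)"
      by (rule sums_mult2[OF summable_sums[OF sB]])
    have le: "\<bar>a (n + 3) * \<epsilon> ^ n * \<epsilon> ^ 3\<bar> \<le> b (n + 3) * \<rho> ^ n * \<epsilon> ^ 3" for n
      using ab[of "n + 3"] \<epsilon> order_trans[OF abs_ge_zero ab[of "n + 3"]]
      by (auto simp: abs_mult intro!: mult_right_mono mult_mono power_mono)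
    show ?thesis
      by (rule abs_leI; rule sums_le[OF _ sums_a sums_b] sums_le[OF _ sums_minus[OF sums_a] sums_b])
         (rule abs_le_D1[OF le] abs_le_D2[OF le])+
  qed
  have coeffs: "a 0 = 0" "a 1 = 0" "a 2 - c = 0"
  proof (atomize (full), intro conjI)
    have "\<bar>a 0 + a 1 * \<epsilon> + (a 2 - c) * \<epsilon>\<^sup>2\<bar> \<le> (?B + K) * \<epsilon> ^ 3" if "0 < \<epsilon>" "\<epsilon> \<le> \<rho>" for \<epsilon>
    proof -
      have "a 0 + a 1 * \<epsilon> + (a 2 - c) * \<epsilon>\<^sup>2 = (P \<epsilon> - c * \<epsilon>\<^sup>2) - (P \<epsilon> - (a 0 + a 1 * \<epsilon> + a 2 * \<epsilon>\<^sup>2))"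
        by (simp add: algebra_simps)
      then show ?thesis
        using tail[OF that] cubic[of \<epsilon>] that \<rho> by (simp add: distrib_right)
    qed
    from quadratic_eq_0_if_cubically_small[OF \<rho> this]
    show "a 0 = 0" "a 1 = 0" "a 2 - c = 0" by simp_all
  qed
  show "\<bar>P \<epsilon> - c * \<epsilon>\<^sup>2\<bar> \<le> ?B * \<epsilon> ^ 3" if "0 < \<epsilon>" "\<epsilon> \<le> \<rho>"
    using tail[OF that] coeffs by simp
  have "(\<lambda>n. a n * 0 ^ n) sums a 0" by (rule powser_sums_zero)
  then show "P 0 = 0"
    using P[of 0] \<rho> coeffs(1) sums_unique2 by fastforce
qed

section \<open>The flow map near the origin\<close>

lemma bounded_multilinear_pathD:
  assumes A: "bounded_multilinear_path T n B A" and t: "t \<in> {0..T}"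
    and hs: "length hs = n" "set hs \<subseteq> sobolev (-1)"
  shows "A hs t \<in> sobolev (-1)"
    and "sobolev_norm (-1) (A hs t) \<le> B * (\<Prod>h\<leftarrow>hs. sobolev_norm (-1) h)"
    and "i < n \<Longrightarrow> h \<in> sobolev (-1) \<Longrightarrow> k \<in> sobolev (-1) \<Longrightarrow>
      A (hs[i := a *\<^sub>R h + b *\<^sub>R k]) t = a *\<^sub>R A (hs[i := h]) t + b *\<^sub>R A (hs[i := k]) t"
proof -
  note * = A[unfolded bounded_multilinear_path_def, THEN spec[of _ hs], THEN mp, OF conjI[OF hs]]
  show "A hs t \<in> sobolev (-1)"
    using *[THEN conjunct1] t unfolding continuous_sobolev_def by simp
  show "sobolev_norm (-1) (A hs t) \<le> B * (\<Prod>h\<leftarrow>hs. sobolev_norm (-1) h)"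
    using *[THEN conjunct2, THEN conjunct1] t by simp
  show "A (hs[i := a *\<^sub>R h + b *\<^sub>R k]) t = a *\<^sub>R A (hs[i := h]) t + b *\<^sub>R A (hs[i := k]) t"
    if "i < n" "h \<in> sobolev (-1)" "k \<in> sobolev (-1)"
    using *[THEN conjunct2, THEN conjunct2] t that by simp
qed

lemma bounded_multilinear_path_homogeneous:
  assumes A: "bounded_multilinear_path T n B A" and h: "h \<in> sobolev (-1)" and t: "t \<in> {0..T}"
  shows "A (replicate n (c *\<^sub>R h)) t = c ^ n *\<^sub>R A (replicate n h) t"
proof -
  \<comment> \<open>The scalar is extracted from one argument after the other.\<close>
  have "A (replicate m (c *\<^sub>R h) @ replicate (n - m) h) t = c ^ m *\<^sub>R A (replicate n h) t" if "m \<le> n" for m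
    using that
  proof (induction m)
    case (Suc m)
    let ?L = "replicate m (c *\<^sub>R h) @ replicate (n - m) h"
    have nm: "n - m = Suc (n - Suc m)" using Suc.prems by simp
    have L: "length ?L = n" "set ?L \<subseteq> sobolev (-1)" "m < n"
      using Suc.prems h sobolev_scaleR[OF h] by auto
    have "?L[m := h] = ?L"
      by (simp add: nm list_update_append)
    moreover have "?L[m := c *\<^sub>R h + 0 *\<^sub>R 0] = replicate (Suc m) (c *\<^sub>R h) @ replicate (n - Suc m) h"
      by (simp add: nm list_update_append replicate_app_Cons_same)
    moreover have "A (?L[m := c *\<^sub>R h + 0 *\<^sub>R 0]) t = c *\<^sub>R A (?L[m := h]) t + 0 *\<^sub>R A (?L[m := 0]) t"
      by (rule bounded_multilinear_pathD(3)[OF A t L h zero_in_sobolev])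
    ultimately show ?case
      using Suc by simp
  qed simp
  from this[of n] show ?thesis by simp
qed

text \<open>The coefficients \<open>a\<close> depend on the direction \<open>h\<close>, but their bound \<open>b\<close> and the radius \<open>\<rho>\<close> do not; this is
where the boundedness of the homogeneous terms on \<open>H^(-1)\<close> is used.\<close>

lemma analytic_observable_expansion:
  assumes analytic: "analytic_path_at T \<Phi> 0" and t: "t \<in> {0..T}"
    and \<Phi>: "\<And>u. u \<in> sobolev (-1) \<Longrightarrow> \<Phi> u t \<in> sobolev (-1)"
    and p: "0 \<le> C" "\<And>u. u \<in> sobolev (-1) \<Longrightarrow> \<bar>dist_apply u f\<bar> \<le> C * sobolev_norm (-1) u"
  obtains \<rho> b where "0 < \<rho>" "\<rho> \<le> 1" "summable (\<lambda>n. b n * \<rho> ^ n)"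
    "\<forall>h\<in>sobolev (-1). sobolev_norm (-1) h \<le> 1 \<longrightarrow>
       (\<exists>a. (\<forall>n. \<bar>a n\<bar> \<le> b n) \<and> (\<forall>\<epsilon>. 0 \<le> \<epsilon> \<longrightarrow> \<epsilon> \<le> \<rho> \<longrightarrow> (\<lambda>n. a n * \<epsilon> ^ n) sums dist_apply (\<Phi> (\<epsilon> *\<^sub>R h) t) f))"
proof -
  obtain A B r where r: "0 < r" and A': "\<forall>n. bounded_multilinear_path T n (B n) (A n)"
    and B: "summable (\<lambda>n. B n * r ^ n)"
    and lim': "\<forall>h\<in>sobolev (-1). sobolev_norm (-1) h < r \<longrightarrow>
        uniform_limit {0..T}
          (\<lambda>N t. sobolev_norm (-1) (\<Phi> (0 + h) t - (\<Sum>n<N. A n (replicate n h) t)))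
          (\<lambda>t. 0) sequentially"
    using analytic unfolding analytic_path_at_def by blast
  note A = A'[rule_format] and lim = lim'[rule_format]
  \<comment> \<open>Strictly inside the radius \<open>r\<close>, so that the series converges absolutely; \<open>B n\<close> may be negative.\<close>
  define \<rho> where "\<rho> = min 1 (r / 2)"
  have \<rho>: "0 < \<rho>" "\<rho> \<le> 1" "\<rho> < r" using r by (auto simp: \<rho>_def)
  define b where "b n = C * \<bar>B n\<bar>" for n
  have "summable (\<lambda>n. norm (B n * \<rho> ^ n))"
    using powser_insidea[OF B, of \<rho>] \<rho> by simp
  then have "summable (\<lambda>n. C * norm (B n * \<rho> ^ n))" by (rule summable_mult)
  then have sb: "summable (\<lambda>n. b n * \<rho> ^ n)"
    using \<rho> by (simp add: b_def abs_mult mult.assoc)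
  have "\<exists>a. (\<forall>n. \<bar>a n\<bar> \<le> b n) \<and> (\<forall>\<epsilon>. 0 \<le> \<epsilon> \<longrightarrow> \<epsilon> \<le> \<rho> \<longrightarrow> (\<lambda>n. a n * \<epsilon> ^ n) sums dist_apply (\<Phi> (\<epsilon> *\<^sub>R h) t) f)"
    if h: "h \<in> sobolev (-1)" "sobolev_norm (-1) h \<le> 1" for h
  proof (intro exI conjI allI impI)
    let ?a = "\<lambda>n. dist_apply (A n (replicate n h) t) f"
    have mem: "A n (replicate n u) t \<in> sobolev (-1)" if "u \<in> sobolev (-1)" for n u
      by (rule bounded_multilinear_pathD(1)[OF A t]) (use that in auto)
    show "\<bar>?a n\<bar> \<le> b n" for n
    proof -
      have "sobolev_norm (-1) (A n (replicate n h) t) \<le> B n * (\<Prod>h\<leftarrow>replicate n h. sobolev_norm (-1) h)"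
        by (rule bounded_multilinear_pathD(2)[OF A t]) (use h in auto)
      also have "\<dots> = B n * sobolev_norm (-1) h ^ n" by (simp add: prod_list_replicate)
      also have "\<dots> \<le> \<bar>B n\<bar> * 1"
        using h(2) sobolev_norm_nonneg[of "-1" h]
        by (intro order_trans[OF mult_right_mono[OF abs_ge_self] mult_left_mono]) (auto intro: power_le_one)
      finally show ?thesis
        using order_trans[OF p(2)[OF mem[OF h(1)]] mult_left_mono[OF _ p(1)]] by (simp add: b_def)
    qed
    fix \<epsilon> :: real assume \<epsilon>: "0 \<le> \<epsilon>" "\<epsilon> \<le> \<rho>"
    let ?h = "\<epsilon> *\<^sub>R h"
    have h': "?h \<in> sobolev (-1)" by (rule sobolev_scaleR[OF h(1)])
    have sum_mem: "(\<Sum>n<N. A n (replicate n ?h) t) \<in> sobolev (-1)" for N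
      by (intro sobolev_sum mem h')
    have "sobolev_norm (-1) ?h \<le> \<epsilon> * 1"
      unfolding sobolev_norm_scaleR using h(2) \<epsilon> by (simp add: mult_left_le)
    then have "sobolev_norm (-1) ?h < r" using \<epsilon> \<rho> by simp
    from tendsto_uniform_limitI[OF lim[OF h' this] t]
    have "(\<lambda>N. sobolev_norm (-1) (\<Phi> ?h t - (\<Sum>n<N. A n (replicate n ?h) t))) \<longlonglongrightarrow> 0" by simp
    then have bound_null: "(\<lambda>N. C * sobolev_norm (-1) (\<Phi> ?h t - (\<Sum>n<N. A n (replicate n ?h) t))) \<longlonglongrightarrow> 0"
      by (rule tendsto_mult_right_zero)
    have "norm ((\<Sum>n<N. ?a n * \<epsilon> ^ n) - dist_apply (\<Phi> ?h t) f)
        \<le> C * sobolev_norm (-1) (\<Phi> ?h t - (\<Sum>n<N. A n (replicate n ?h) t))" for N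
    proof -
      have "dist_apply (A n (replicate n ?h) t) f = ?a n * \<epsilon> ^ n" for n
        by (simp add: bounded_multilinear_path_homogeneous[OF A h(1) t] scaleR_distribution.rep_eq)
      then have "dist_apply (\<Phi> ?h t - (\<Sum>n<N. A n (replicate n ?h) t)) f = dist_apply (\<Phi> ?h t) f - (\<Sum>n<N. ?a n * \<epsilon> ^ n)"
        by (simp add: dist_apply_diff dist_apply_sum)
      then show ?thesis
        using p(2)[OF sobolev_diff[OF \<Phi>[OF h'] sum_mem[of N]]] by (simp add: abs_minus_commute)
    qed
    then have "(\<lambda>N. (\<Sum>n<N. ?a n * \<epsilon> ^ n) - dist_apply (\<Phi> ?h t) f) \<longlonglongrightarrow> 0"
      by (intro Lim_null_comparison[OF _ bound_null] always_eventually allI)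
    then show "(\<lambda>n. ?a n * \<epsilon> ^ n) sums dist_apply (\<Phi> ?h t) f"
      unfolding sums_def by (rule LIM_zero_cancel)
  qed
  then show ?thesis
    by (intro that[OF \<rho>(1,2) sb]) blast
qed

text \<open>For smooth data the flow is given by classical solutions, to which \<open>second_order_expansion\<close> applies.\<close>

lemma flow_second_order_expansion:
  assumes \<Phi>: "kdvb_flow_map \<Phi>" and N: "2 \<le> N" and t: "0 \<le> t"
    and d: "represents (pair_wave N 0 0) d"
  shows "\<exists>K. \<forall>\<epsilon>. 0 < \<epsilon> \<longrightarrow> \<epsilon> \<le> 1 \<longrightarrow>
      \<bar>dist_apply (\<Phi> (\<epsilon> *\<^sub>R d) t) (observable t) - quadratic_coeff N t * \<epsilon>\<^sup>2\<bar> \<le> K * \<epsilon> ^ 3"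
proof -
  obtain K where K: "\<forall>\<epsilon> V. 0 < \<epsilon> \<longrightarrow> \<epsilon> \<le> 1 \<longrightarrow> kdvb_jet V (\<lambda>t x. V 0 t x * V 1 t x) \<longrightarrow>
      (\<forall>x. V 0 0 x = \<epsilon> * pair_wave N 0 0 x) \<longrightarrow>
      \<bar>integral {0..2*pi} (\<lambda>x. V 0 t x * backward_wave 0 t x) - quadratic_coeff N t * \<epsilon>\<^sup>2\<bar> \<le> K * \<epsilon> ^ 3"
    using second_order_expansion[OF N t] ..
  show ?thesis
  proof (intro exI[of _ K] allI impI)
    fix \<epsilon> :: real assume \<epsilon>: "0 < \<epsilon>" "\<epsilon> \<le> 1"
    let ?f = "\<lambda>x. \<epsilon> * pair_wave N 0 0 x"
    have "smooth_real (pair_wave N 0 0)"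
      unfolding pair_wave_initial[abs_def]
      using smooth_real_cos[of _ 0] by (intro smooth_real_add smooth_real_cmult) simp_all
    moreover have "torus_periodic (pair_wave N 0 0)"
      unfolding torus_periodic_def using kdvb_jetD(3)[OF pair_wave_jet] by simp
    ultimately have "smooth_real ?f" "torus_periodic ?f"
      by (auto intro: smooth_real_cmult simp: torus_periodic_def)
    then obtain v where v: "classical_solution ?f v" "\<forall>t\<ge>0. represents (v t) (\<Phi> (\<epsilon> *\<^sub>R d) t)"
      using \<Phi> represents_scaleR[OF d, of \<epsilon>] unfolding kdvb_flow_map_def by blast
    obtain V where V: "kdvb_jet V (\<lambda>t x. V 0 t x * V 1 t x)" "V 0 = v"
      by (rule classical_solution_jet[OF v(1)])
    have "continuous_on {0..2*pi} (v t)"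
      using kdvb_jetD(4)[OF V(1) t, of 0] V(2)
      by (intro continuous_at_imp_continuous_on ballI DERIV_isCont) auto
    then have "dist_apply (\<Phi> (\<epsilon> *\<^sub>R d) t) (observable t) = integral {0..2*pi} (\<lambda>x. V 0 t x * backward_wave 0 t x)"
      using representsD[of "v t"] v(2) t V(2) by (simp add: test_fun_observable)
    moreover have "V 0 0 x = ?f x" for x
      using v(1) V(2) unfolding classical_solution_def by simp
    ultimately show "\<bar>dist_apply (\<Phi> (\<epsilon> *\<^sub>R d) t) (observable t) - quadratic_coeff N t * \<epsilon>\<^sup>2\<bar> \<le> K * \<epsilon> ^ 3"
      using K[rule_format, OF \<epsilon> V(1)] by simp
  qed
qed

text \<open>Evaluation at a test function is continuous for the weak topology of distributions.\<close>

lemma dist_continuity_imp_observable_bound: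
  assumes cont: "topcontinuous_at (subtopology (sobolev_topology s) (sobolev r)) dist_topology \<Psi> u0"
    and \<eta>: "0 < \<eta>"
  shows "\<exists>\<delta>>0. \<forall>u\<in>sobolev r \<inter> sobolev s. sobolev_norm s (u - u0) < \<delta> \<longrightarrow>
       \<bar>dist_apply (\<Psi> u) f - dist_apply (\<Psi> u0) f\<bar> < \<eta>"
proof -
  let ?O = "{g :: test \<Rightarrow> real. \<bar>g f - dist_apply (\<Psi> u0) f\<bar> < \<eta>}"
  have "open ?O"
    by (intro open_Collect_less continuous_intros continuous_on_product_coordinates)
  then have "openin dist_topology (dist_apply -` ?O)"
    unfolding dist_topology_def openin_pullback_topology by auto
  moreover have "\<Psi> u0 \<in> dist_apply -` ?O" using \<eta> by simp
  ultimately obtain U where U: "openin (subtopology (sobolev_topology s) (sobolev r)) U" "u0 \<in> U"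
      "\<forall>u\<in>U. \<Psi> u \<in> dist_apply -` ?O"
    using cont unfolding topcontinuous_at_def by meson
  then obtain W where W: "openin (sobolev_topology s) W" "U = W \<inter> sobolev r"
    unfolding openin_subtopology by blast
  then obtain \<delta> where "0 < \<delta>" "\<forall>v\<in>sobolev s. sobolev_norm s (v - u0) < \<delta> \<longrightarrow> v \<in> W"
    using U(2) unfolding openin_sobolev_topology by blast
  then show ?thesis using U(3) W(2) by (intro exI[of _ \<delta>]) auto
qed

theorem theorem1p2:
  fixes s :: real and \<Phi> :: "distribution \<Rightarrow> real \<Rightarrow> distribution"
  assumes "s < -1" and "kdvb_flow_map \<Phi>"
  shows "\<exists>T>0. \<forall>t. 0 < t \<and> t < T \<longrightarrow>
           \<not> topcontinuous_at (subtopology (sobolev_topology s) (sobolev (-1))) dist_topology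
               (\<lambda>u0. \<Phi> u0 t) 0"
proof -
  obtain T R where T: "0 < T" and "0 < R"
    "\<forall>v\<in>sobolev (-1). sobolev_norm (-1) (v - 0) < R \<longrightarrow> analytic_path_at T \<Phi> v"
    using assms(2) zero_in_sobolev[of "-1"] unfolding kdvb_flow_map_def by meson
  moreover have "sobolev_norm (-1) (0 - 0) = 0"
    using sobolev_norm_scaleR[of "-1" 0 0] by simp
  ultimately have analytic: "analytic_path_at T \<Phi> 0"
    using zero_in_sobolev[of "-1"] by fastforce
  have "\<not> topcontinuous_at (subtopology (sobolev_topology s) (sobolev (-1))) dist_topology (\<lambda>u0. \<Phi> u0 t) 0"
    if t: "0 < t" "t < T" for t
  proof
    assume cont: "topcontinuous_at (subtopology (sobolev_topology s) (sobolev (-1))) dist_topology (\<lambda>u0. \<Phi> u0 t) 0"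
    let ?P = "\<lambda>u. dist_apply (\<Phi> u t) (observable t)"
    obtain C where C: "0 \<le> C" "\<forall>u\<in>sobolev (-1). \<bar>dist_apply u (observable t)\<bar> \<le> C * sobolev_norm (-1) u"
      using observable_bounded[of t] by blast
    have flow_mem: "\<Phi> u t \<in> sobolev (-1)" if "u \<in> sobolev (-1)" for u
      using assms(2) that t unfolding kdvb_flow_map_def continuous_sobolev_def by auto
    have tT: "t \<in> {0..T}" using t by simp
    obtain \<rho> b where \<rho>: "0 < \<rho>" "\<rho> \<le> 1" and b: "summable (\<lambda>n. b n * \<rho> ^ n)"
      and series: "\<forall>h\<in>sobolev (-1). sobolev_norm (-1) h \<le> 1 \<longrightarrow>
        (\<exists>a. (\<forall>n. \<bar>a n\<bar> \<le> b n) \<and> (\<forall>\<epsilon>. 0 \<le> \<epsilon> \<longrightarrow> \<epsilon> \<le> \<rho> \<longrightarrow> (\<lambda>n. a n * \<epsilon> ^ n) sums ?P (\<epsilon> *\<^sub>R h)))"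
      by (rule analytic_observable_expansion[OF analytic tT flow_mem C(1) C(2)[rule_format]])
    define B where "B = (\<Sum>n. b (n + 3) * \<rho> ^ n)"
    define d where "d N = (SOME u. represents (pair_wave N 0 0) u)" for N
    have d: "represents (pair_wave N 0 0) (d N)" for N
      unfolding d_def by (rule someI_ex[OF continuous_represents_distribution[OF continuous_pair_wave_initial]])
    have d_mem: "d N \<in> sobolev (-1)" "d N \<in> sobolev s" and d_norm: "sobolev_norm (-1) (d N) \<le> 1"
      "sobolev_norm s (d N) \<le> real N powr (1 + s)" if "1 \<le> N" for N
      using pair_wave_sobolev[OF d that, of "-1"] pair_wave_sobolev[OF d that, of s] assms(1) that by simp_all
    have uniform: "?P 0 = 0" "\<And>\<epsilon>. 0 < \<epsilon> \<Longrightarrow> \<epsilon> \<le> \<rho> \<Longrightarrow> \<bar>?P (\<epsilon> *\<^sub>R d N) - quadratic_coeff N t * \<epsilon>\<^sup>2\<bar> \<le> B * \<epsilon> ^ 3"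
      if N: "2 \<le> N" for N
    proof -
      have N1: "1 \<le> N" using N by simp
      obtain a where a: "\<And>n. \<bar>a n\<bar> \<le> b n"
        "\<And>\<epsilon>. 0 \<le> \<epsilon> \<Longrightarrow> \<epsilon> \<le> \<rho> \<Longrightarrow> (\<lambda>n. a n * \<epsilon> ^ n) sums ?P (\<epsilon> *\<^sub>R d N)"
        using series[rule_format, OF d_mem(1)[OF N1] d_norm(1)[OF N1]] by blast
      obtain K where K: "\<forall>\<epsilon>. 0 < \<epsilon> \<longrightarrow> \<epsilon> \<le> 1 \<longrightarrow> \<bar>?P (\<epsilon> *\<^sub>R d N) - quadratic_coeff N t * \<epsilon>\<^sup>2\<bar> \<le> K * \<epsilon> ^ 3"
        using flow_second_order_expansion[OF assms(2) N less_imp_le[OF t(1)] d] ..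
      show "?P 0 = 0"
        using power_series_cubic_remainder(1)[of \<rho> a "\<lambda>\<epsilon>. ?P (\<epsilon> *\<^sub>R d N)", OF a(2,1) b \<rho> K[rule_format]] by simp
      show "\<bar>?P (\<epsilon> *\<^sub>R d N) - quadratic_coeff N t * \<epsilon>\<^sup>2\<bar> \<le> B * \<epsilon> ^ 3" if "0 < \<epsilon>" "\<epsilon> \<le> \<rho>" for \<epsilon>
        using power_series_cubic_remainder(2)[of \<rho> a "\<lambda>\<epsilon>. ?P (\<epsilon> *\<^sub>R d N)", OF a(2,1) b \<rho> K[rule_format] that]
        by (simp add: B_def)
    qed
    \<comment> \<open>Small enough for the cubic remainder to be at most half of the quadratic term, whose coefficient
is at least \<open>\<pi>/26\<close>.\<close>
    define \<epsilon> where "\<epsilon> = min \<rho> (pi / (52 * (\<bar>B\<bar> + 1)))"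
    have \<epsilon>: "0 < \<epsilon>" "\<epsilon> \<le> \<rho>" using \<rho> by (auto simp: \<epsilon>_def)
    have "B * \<epsilon> \<le> (\<bar>B\<bar> + 1) * \<epsilon>" using \<epsilon> by (intro mult_right_mono) auto
    also have "\<dots> \<le> (\<bar>B\<bar> + 1) * (pi / (52 * (\<bar>B\<bar> + 1)))" by (intro mult_left_mono) (auto simp: \<epsilon>_def)
    also have "\<dots> = pi / 52" by (simp add: field_simps add_eq_0_iff)
    finally have B\<epsilon>: "B * \<epsilon> ^ 3 \<le> pi / 52 * \<epsilon>\<^sup>2"
      using mult_right_mono[of "B * \<epsilon>" "pi / 52" "\<epsilon>\<^sup>2"] by (simp add: eval_nat_numeral mult.assoc)
    obtain \<delta> where \<delta>: "0 < \<delta>" "\<forall>u\<in>sobolev (-1) \<inter> sobolev s. sobolev_norm s (u - 0) < \<delta> \<longrightarrow>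
       \<bar>?P u - ?P 0\<bar> < pi / 52 * \<epsilon>\<^sup>2"
      using dist_continuity_imp_observable_bound[OF cont, of "pi / 52 * \<epsilon>\<^sup>2" "observable t"] \<epsilon>(1) by (simp, blast)
    have "((\<lambda>N. \<epsilon> * real N powr (1 + s)) \<longlongrightarrow> \<epsilon> * 0) sequentially"
      using assms(1) by (intro tendsto_intros tendsto_neg_powr filterlim_real_sequentially) auto
    then have "\<forall>\<^sub>F N in sequentially. \<epsilon> * real N powr (1 + s) < \<delta>"
      using \<delta>(1) by (intro order_tendstoD(2)[where y = 0]) auto
    \<comment> \<open>From here on the quadratic coefficient is at least \<open>\<pi>/26\<close>.\<close>
    moreover have "\<forall>\<^sub>F N in sequentially. 2 / t \<le> real N"
      using filterlim_real_sequentially unfolding filterlim_at_top by blast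
    ultimately have "\<forall>\<^sub>F N in sequentially. 2 \<le> N \<and> 2 / t \<le> real N \<and> \<epsilon> * real N powr (1 + s) < \<delta>"
      using eventually_ge_at_top[of 2] by eventually_elim auto
    then obtain N where N: "2 \<le> N" "2 / t \<le> real N" "\<epsilon> * real N powr (1 + s) < \<delta>"
      by (auto simp: eventually_sequentially)
    have "sobolev_norm s (\<epsilon> *\<^sub>R d N - 0) \<le> \<epsilon> * real N powr (1 + s)"
      using d_norm(2)[of N] N(1) \<epsilon> by (simp add: sobolev_norm_scaleR)
    then have "\<bar>?P (\<epsilon> *\<^sub>R d N)\<bar> < pi / 52 * \<epsilon>\<^sup>2"
      using \<delta>(2)[rule_format, of "\<epsilon> *\<^sub>R d N"] sobolev_scaleR[OF d_mem(1)] sobolev_scaleR[OF d_mem(2)] N(1,3) uniform(1)[OF N(1)]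
      by simp
    moreover have "pi / 26 * \<epsilon>\<^sup>2 \<le> quadratic_coeff N t * \<epsilon>\<^sup>2"
      using quadratic_coeff_lower_bound[of N t] N t by (intro mult_right_mono) (auto simp: field_simps)
    ultimately show False
      using uniform(2)[OF N(1) \<epsilon>] B\<epsilon> by linarith
  qed
  with T show ?thesis by blast
qed

end
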